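(* Let $p \geq \sqrt{3}$ and let $u$ be a global-in-time Schwartz solution, not identically zero, of the defocusing generalized Korteweg--de Vries equation $\partial_t u + \partial_{xxx} u = \partial_x(|u|^{p-1}u)$. Then there exists a constant $C>0$, depending only on $p$ and the initial datum $u(0)$, such that for all $z>0$ $$ \left|\left\{t>0: I(u(t)) \leq z \right\}\right| \leq C\, z^{\frac{p}{2}},$$ where $|\cdot|$ denotes Lebesgue measure on $\mathbb{R}$.
   Context: Solutions $u=u(t,x)$ are real-valued functions of $(t,x)\in\mathbb{R}\times\mathbb{R}$, and $u(t)$ denotes the function $x\mapsto u(t,x)$. A global-in-time Schwartz solution is a classical solution defined for all $t\in\mathbb{R}$ such that $u(t)\in\mathcal{S}(\mathbb{R})$ for every $t$, with $t\mapsto u(t)$ continuously differentiable into $\mathcal{S}(\mathbb{R})$. For a function $f$ on $\mathbb{R}$, $$ I(f) := \int_{\mathbb{R}}\int_{\mathbb{R}} f(x)^2 (x-y)^2 f(y)^2 \,dx\,dy .$$ *)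

theory Defs
  imports "HOL-Analysis.Analysis"
begin

definition schwartz :: "(real \<Rightarrow> real) \<Rightarrow> bool" where
  "schwartz f \<longleftrightarrow>
     (\<forall>n x. (deriv ^^ n) f differentiable at x) \<and>
     (\<forall>k n. bounded (range (\<lambda>x. x ^ k * (deriv ^^ n) f x)))"

text \<open>The supremum below is the usual one only for functions with a finite seminorm; it is
  applied only to Schwartz functions.\<close>

definition schwartz_seminorm :: "nat \<Rightarrow> nat \<Rightarrow> (real \<Rightarrow> real) \<Rightarrow> real" where
  "schwartz_seminorm k n f = (SUP x. \<bar>x ^ k * (deriv ^^ n) f x\<bar>)"

definition schwartz_tendsto ::
    "('a \<Rightarrow> real \<Rightarrow> real) \<Rightarrow> (real \<Rightarrow> real) \<Rightarrow> 'a filter \<Rightarrow> bool" where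
  "schwartz_tendsto g l F \<longleftrightarrow>
     (\<forall>k n. ((\<lambda>s. schwartz_seminorm k n (\<lambda>x. g s x - l x)) \<longlongrightarrow> 0) F)"

definition schwartz_C1 :: "(real \<Rightarrow> real \<Rightarrow> real) \<Rightarrow> bool" where
  "schwartz_C1 u \<longleftrightarrow>
     (\<forall>t. schwartz (u t)) \<and>
     (\<exists>v. (\<forall>t. schwartz (v t)) \<and>
          (\<forall>t. schwartz_tendsto (\<lambda>h x. (u (t + h) x - u t x) / h) (v t) (at 0)) \<and>
          (\<forall>t. schwartz_tendsto v (v t) (at t)))"

text \<open>For \<open>p > 1\<close> all the derivatives in the equation exist: those of \<open>u\<close> because of
  \<open>schwartz_C1\<close>, that of the nonlinearity because \<open>r \<mapsto> \<bar>r\<bar> powr (p - 1) * r\<close> is then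
  continuously differentiable (with value \<open>0\<close> at \<open>r = 0\<close>).\<close>

definition gkdv_schwartz_solution :: "real \<Rightarrow> (real \<Rightarrow> real \<Rightarrow> real) \<Rightarrow> bool" where
  "gkdv_schwartz_solution p u \<longleftrightarrow>
     schwartz_C1 u \<and>
     (\<forall>t x. deriv (\<lambda>s. u s x) t + (deriv ^^ 3) (u t) x
          = deriv (\<lambda>y. \<bar>u t y\<bar> powr (p - 1) * u t y) x)"

definition interaction :: "(real \<Rightarrow> real) \<Rightarrow> real" where
  "interaction f =
     (\<integral>y. (\<integral>x. (f x)\<^sup>2 * (x - y)\<^sup>2 * (f y)\<^sup>2 \<partial>lborel) \<partial>lborel)"

end

theory Submission
  imports Defs "HOL-Probability.Sinc_Integral"
begin

text \<open>Let \<open>D(t)\<close> be the distance of the centre of energy to the left of the centre of mass, times mass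
  and energy. For \<open>p \<ge> \<surd>3\<close> the Cauchy--Schwarz inequality gives \<open>D' \<ge> c B\<^sup>2\<close> with
  \<open>B = \<integral>\<bar>u\<bar>\<^bsup>p+1\<^esup>\<close>, so \<open>D\<close> is increasing. Where \<open>I(u(t)) \<le> z\<close> the mass is concentrated on the scale
  \<open>\<surd>z\<close>, so that \<open>B\<^sup>2\<close> is at least of order \<open>z\<^bsup>-(p-1)/2\<^esup>\<close>; moreover \<open>D\<^sup>2 \<le> z (D' + C)\<close>, because
  \<open>D'\<close> controls \<open>\<integral>u\<^sub>x\<^sub>x\<^sup>2\<close>. Hence the increasing function \<open>arctan (D / \<surd>z)\<close>, whose total variation is at
  most \<open>\<pi>\<close>, has there a derivative of order at least \<open>z\<^bsup>-p/2\<^esup>\<close>.\<close>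

subsection \<open>Rapidly decaying functions\<close>

text \<open>\<open>D'\<close> contains \<open>K\<close>, the integral of \<open>uxx\<close> squared,
  which mass and energy do not bound, so the estimate for \<open>D\<close> squared gives no bound of
  order z. The arctangent turns this to advantage. Its derivative is (D'/sqrt z) / (1 + D^2/z),
  which is at least (D'/sqrt z) / (1 + D' + C). That quotient increases with D', so a lower bound on
  D' suffices, however large D' may be. The factor 1/sqrt z and the order z^(-(p-1)/2) of B^2
  multiply to the exponent -p/2. Both centres move to the left, so the real issue is to compare
  their speeds. \<open>D\<close> pairs the two first moments so that it is invariant under
  translations, as the interaction is; this permits measuring x from the centre of mass. Every
  constant is built from p, mass and energy; the latter two are conserved, hence determined by the
  initial datum.\<close>

definition rapid :: "(real \<Rightarrow> real) \<Rightarrow> bool" where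
  "rapid f \<longleftrightarrow> continuous_on UNIV f \<and> (\<forall>k. bounded (range (\<lambda>x. x ^ k * f x)))"

lemma rapid_continuous: "rapid f \<Longrightarrow> continuous_on UNIV f"
  by (simp add: rapid_def)

lemma rapid_bounded: "rapid f \<Longrightarrow> bounded (range f)"
  unfolding rapid_def by (auto dest!: spec[of _ 0])

lemma rapid_add:
  assumes "rapid f" "rapid g"
  shows "rapid (\<lambda>x. f x + g x)"
proof -
  have "bounded (range (\<lambda>x. x ^ k * (f x + g x)))" for k
    using bounded_plus_comp[of "\<lambda>x. x ^ k * f x" UNIV "\<lambda>x. x ^ k * g x"] assms
    by (simp add: rapid_def distrib_left)
  then show ?thesis
    using assms by (auto simp: rapid_def intro: continuous_on_add)
qed

text \<open>This form admits the factor |u|^(p-1), which is bounded and continuous but may fail to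
  be smooth where u vanishes. Products with it can leave the Schwartz class, yet stay
  \<open>rapid\<close>.\<close>

lemma rapid_mult_bounded:
  assumes "continuous_on UNIV g" "bounded (range g)" "rapid f"
  shows "rapid (\<lambda>x. g x * f x)"
proof -
  obtain B where B: "\<And>x. \<bar>g x\<bar> \<le> B"
    using assms(2) by (auto simp: bounded_iff)
  have "bounded (range (\<lambda>x. x ^ k * (g x * f x)))" for k
  proof -
    obtain C where C: "\<And>x. \<bar>x ^ k * f x\<bar> \<le> C"
      using assms(3) by (auto simp: bounded_iff rapid_def)
    have "\<bar>x ^ k * (g x * f x)\<bar> \<le> B * C" for x
      using mult_mono[OF B[of x] C[of x]] order_trans[OF abs_ge_zero B[of x]]
      by (simp add: abs_mult algebra_simps)
    then show ?thesis
      by (auto simp: bounded_iff)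
  qed
  then show ?thesis
    using assms by (auto simp: rapid_def intro: continuous_on_mult)
qed

lemma rapid_mult: "rapid f \<Longrightarrow> rapid g \<Longrightarrow> rapid (\<lambda>x. f x * g x)"
  by (intro rapid_mult_bounded rapid_continuous rapid_bounded)

lemma rapid_cmult: "rapid f \<Longrightarrow> rapid (\<lambda>x. c * f x)" for c :: real
  by (rule rapid_mult_bounded) auto

lemma rapid_uminus: "rapid f \<Longrightarrow> rapid (\<lambda>x. - f x)"
  using rapid_cmult[of f "-1"] by simp

lemma rapid_diff: "rapid f \<Longrightarrow> rapid g \<Longrightarrow> rapid (\<lambda>x. f x - g x)"
  using rapid_add[OF _ rapid_uminus] by fastforce

lemma rapid_power_mult:
  assumes "rapid f"
  shows "rapid (\<lambda>x. x ^ j * f x)"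
proof -
  have "bounded (range (\<lambda>x. x ^ k * (x ^ j * f x)))" for k
    using assms unfolding rapid_def by (simp add: mult.assoc[symmetric] power_add[symmetric])
  then show ?thesis
    using assms by (auto simp: rapid_def intro!: continuous_intros)
qed

lemma rapid_shift_mult: "rapid f \<Longrightarrow> rapid (\<lambda>x. (x - c) * f x)"
  using rapid_diff[OF rapid_power_mult[of f 1] rapid_cmult[of f c]]
  by (simp add: algebra_simps)

lemma rapid_power2: "rapid f \<Longrightarrow> rapid (\<lambda>x. (f x)\<^sup>2)"
  unfolding power2_eq_square by (rule rapid_mult)

lemmas rapid_intros = rapid_add rapid_mult rapid_cmult rapid_uminus rapid_diff
  rapid_power_mult rapid_shift_mult rapid_power2

lemma integrable_lborel_inverse_1_plus_square: "integrable lborel (\<lambda>x::real. C / (1 + x\<^sup>2))"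
  using integrable_inverse_1_plus_square
  by (simp add: set_integrable_def divide_inverse)

text \<open>The weights 1 and x^2 alone already give an integrable majorant.\<close>

lemma decay_by_inverse_square:
  fixes x y :: real
  assumes "\<bar>y\<bar> \<le> B" "\<bar>x ^ 2 * y\<bar> \<le> C"
  shows "\<bar>y\<bar> \<le> (B + C) / (1 + x\<^sup>2)"
proof -
  have "\<bar>y\<bar> * (1 + x\<^sup>2) = \<bar>y\<bar> + \<bar>x ^ 2 * y\<bar>"
    by (simp add: abs_mult algebra_simps)
  moreover have "0 < 1 + x\<^sup>2"
    by (simp add: add_pos_nonneg)
  ultimately show ?thesis
    using assms by (simp add: pos_le_divide_eq)
qed

lemma rapid_decay:
  assumes "rapid f"
  obtains C where "\<And>x. \<bar>f x\<bar> \<le> C / (1 + x\<^sup>2)"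
proof -
  obtain B where B: "\<And>x. \<bar>f x\<bar> \<le> B"
    using rapid_bounded[OF assms] by (auto simp: bounded_iff)
  obtain C where C: "\<And>x. \<bar>x ^ 2 * f x\<bar> \<le> C"
    using assms unfolding rapid_def bounded_iff by (metis rangeI real_norm_def)
  show thesis
    using that decay_by_inverse_square[OF B C] by blast
qed

lemma rapid_measurable: "rapid f \<Longrightarrow> f \<in> borel_measurable borel"
  by (simp add: rapid_def borel_measurable_continuous_onI)

lemma rapid_integrable [intro]:
  assumes "rapid f"
  shows "integrable lborel f"
proof -
  obtain C where C: "\<And>x. \<bar>f x\<bar> \<le> C / (1 + x\<^sup>2)"
    using rapid_decay[OF assms] by blast
  show ?thesis
    by (rule Bochner_Integration.integrable_bound[OF integrable_lborel_inverse_1_plus_square[of C]])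
       (use rapid_measurable[OF assms] in \<open>auto intro!: AE_I2 order_trans[OF C] divide_right_mono add_nonneg_nonneg\<close>)
qed

lemma rapid_tendsto_0:
  assumes "rapid f"
  shows "(f \<longlongrightarrow> 0) at_top" "(f \<longlongrightarrow> 0) at_bot"
proof -
  obtain C where C: "\<And>x. \<bar>f x\<bar> \<le> C / (1 + x\<^sup>2)"
    using rapid_decay[OF assms] by blast
  have "((\<lambda>x::real. C / (1 + x\<^sup>2)) \<longlongrightarrow> 0) at_top" "((\<lambda>x::real. C / (1 + x\<^sup>2)) \<longlongrightarrow> 0) at_bot"
    by real_asymp+
  then show "(f \<longlongrightarrow> 0) at_top" "(f \<longlongrightarrow> 0) at_bot"
    by (auto intro: Lim_null_comparison[of f "\<lambda>x. C / (1 + x\<^sup>2)"] always_eventually simp: C)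
qed

lemma integral_derivative_eq_0:
  assumes "\<And>x. (F has_real_derivative f x) (at x)" "rapid F" "rapid f"
  shows "(\<integral>x. f x \<partial>lborel) = 0"
proof -
  have "(LBINT x=-\<infinity>..\<infinity>. f x) = 0 - 0"
  proof (rule interval_integral_FTC_integrable)
    show "((F \<circ> real_of_ereal) \<longlongrightarrow> 0) (at_left \<infinity>)" "((F \<circ> real_of_ereal) \<longlongrightarrow> 0) (at_right (-\<infinity>))"
      using rapid_tendsto_0[OF assms(2)]
      by (simp_all only: ereal_tendsto_simps1)
  qed (use assms in \<open>auto simp: has_real_derivative_iff_has_vector_derivative set_integrable_def
          rapid_integrable rapid_def continuous_on_eq_continuous_at\<close>)
  then show ?thesis
    by (simp add: interval_lebesgue_integral_def set_lebesgue_integral_def)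
qed

lemma Cauchy_Schwarz_lborel:
  fixes f g :: "real \<Rightarrow> real"
  assumes "rapid f" "rapid g"
  shows "(\<integral>x. f x * g x \<partial>lborel)\<^sup>2 \<le> (\<integral>x. (f x)\<^sup>2 \<partial>lborel) * (\<integral>x. (g x)\<^sup>2 \<partial>lborel)"
proof -
  define a b c where "a = (\<integral>x. (f x)\<^sup>2 \<partial>lborel)" and "b = (\<integral>x. f x * g x \<partial>lborel)"
    and "c = (\<integral>x. (g x)\<^sup>2 \<partial>lborel)"
  \<comment> \<open>The form is kept homogeneous in s and r so that a vanishing norm of either
    function needs no division.\<close>
  have ge0: "0 \<le> s\<^sup>2 * a + 2 * s * r * b + r\<^sup>2 * c" for s r
  proof -
    have "(\<integral>x. (s * f x + r * g x)\<^sup>2 \<partial>lborel)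
        = (\<integral>x. s\<^sup>2 * (f x)\<^sup>2 + (2 * s * r) * (f x * g x) + r\<^sup>2 * (g x)\<^sup>2 \<partial>lborel)"
      by (rule Bochner_Integration.integral_cong) (simp_all add: power2_eq_square algebra_simps)
    also have "\<dots> = s\<^sup>2 * a + 2 * s * r * b + r\<^sup>2 * c"
      using assms by (simp add: a_def b_def c_def rapid_integrable rapid_intros)
    finally show ?thesis
      using integral_nonneg_AE[of "\<lambda>x. (s * f x + r * g x)\<^sup>2" lborel] by simp
  qed
  have "a \<ge> 0" "c \<ge> 0"
    using ge0[of 1 0] ge0[of 0 1] by auto
  have "b\<^sup>2 \<le> a * c"
  proof (cases "a = 0 \<and> c = 0")
    case True
    then show ?thesis
      using ge0[of 1 1] ge0[of 1 "-1"] by simp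
  next
    case False
    \<comment> \<open>The form at (-b, a) and at (c, -b) is the discriminant a c - b^2 times a and
      times c; one of these factors is positive.\<close>
    have 1: "0 \<le> a * (a * c - b\<^sup>2)"
      using ge0[of "-b" a] by (simp add: power2_eq_square algebra_simps)
    have 2: "0 \<le> c * (a * c - b\<^sup>2)"
      using ge0[of c "-b"] by (simp add: power2_eq_square algebra_simps)
    show ?thesis
      using 1 2 False \<open>a \<ge> 0\<close> \<open>c \<ge> 0\<close> by (smt (verit) zero_le_mult_iff)
  qed
  then show ?thesis
    by (simp add: a_def b_def c_def)
qed

text \<open>If the integral vanished, the open nonempty set where f is nonzero would be
  negligible.\<close>

lemma integral_square_pos:
  fixes f :: "real \<Rightarrow> real"
  assumes "rapid f" "f x0 \<noteq> 0"
  shows "(\<integral>x. (f x)\<^sup>2 \<partial>lborel) > 0"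
proof -
  have int: "integrable lborel (\<lambda>x. (f x)\<^sup>2)"
    using assms by (intro rapid_integrable rapid_intros)
  have "(\<integral>x. (f x)\<^sup>2 \<partial>lborel) \<noteq> 0"
  proof
    assume "(\<integral>x. (f x)\<^sup>2 \<partial>lborel) = 0"
    then have "AE x in lborel. f x = 0"
      using integral_nonneg_eq_0_iff_AE[OF int] by simp
    then have "AE x in lebesgue. f x = 0"
      by (rule AE_completion)
    then have "negligible {x. f x \<noteq> 0}"
      by (simp add: negligible_iff_null_sets AE_iff_null_sets eventually_ae_filter)
        (metis (no_types, lifting) null_sets_completion_subset)
    moreover have "open {x. f x \<noteq> 0}"
      using rapid_continuous[OF assms(1)] by (intro open_Collect_neq continuous_intros)
    ultimately show False
      using open_not_negligible assms(2) by blast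
  qed
  moreover have "(\<integral>x. (f x)\<^sup>2 \<partial>lborel) \<ge> 0"
    by (rule integral_nonneg_AE) simp
  ultimately show ?thesis
    by linarith
qed

subsection \<open>Differentiation under the integral sign\<close>

text \<open>Decay with constants uniform for nearby times, as dominated convergence needs. The
  neighbourhood may depend on k, because Schwartz convergence controls one seminorm at a
  time.\<close>

definition locally_rapid :: "(real \<Rightarrow> real \<Rightarrow> real) \<Rightarrow> bool" where
  "locally_rapid f \<longleftrightarrow> (\<forall>t k. \<exists>C. \<forall>\<^sub>F s in nhds t. \<forall>x. \<bar>x ^ k * f s x\<bar> \<le> C)"

definition locally_bounded :: "(real \<Rightarrow> real \<Rightarrow> real) \<Rightarrow> bool" where
  "locally_bounded f \<longleftrightarrow> (\<forall>t. \<exists>C. \<forall>\<^sub>F s in nhds t. \<forall>x. \<bar>f s x\<bar> \<le> C)"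

lemma locally_rapidE:
  assumes "locally_rapid f"
  obtains C where "\<forall>\<^sub>F s in nhds t. \<forall>x. \<bar>x ^ k * f s x\<bar> \<le> C"
  using assms by (auto simp: locally_rapid_def)

lemma locally_rapid_imp_bounded: "locally_rapid f \<Longrightarrow> locally_bounded f"
  unfolding locally_bounded_def
proof
  fix t
  assume "locally_rapid f"
  then obtain C where "\<forall>\<^sub>F s in nhds t. \<forall>x. \<bar>x ^ 0 * f s x\<bar> \<le> C"
    by (rule locally_rapidE)
  then show "\<exists>C. \<forall>\<^sub>F s in nhds t. \<forall>x. \<bar>f s x\<bar> \<le> C"
    by auto
qed

lemma locally_rapid_mult_bounded:
  assumes "locally_bounded f" "locally_rapid g"
  shows "locally_rapid (\<lambda>t x. f t x * g t x)"
  unfolding locally_rapid_def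
proof (intro allI)
  fix t :: real and k :: nat
  obtain B where B: "\<forall>\<^sub>F s in nhds t. \<forall>x. \<bar>f s x\<bar> \<le> B"
    using assms by (auto simp: locally_bounded_def)
  obtain C where C: "\<forall>\<^sub>F s in nhds t. \<forall>x. \<bar>x ^ k * g s x\<bar> \<le> C"
    using assms(2) by (rule locally_rapidE)
  show "\<exists>C. \<forall>\<^sub>F s in nhds t. \<forall>x. \<bar>x ^ k * (f s x * g s x)\<bar> \<le> C"
  proof (intro exI eventually_mono[OF eventually_conj[OF B C]] allI)
    fix s x :: real
    assume *: "(\<forall>x. \<bar>f s x\<bar> \<le> B) \<and> (\<forall>x. \<bar>x ^ k * g s x\<bar> \<le> C)"
    then have "\<bar>f s x\<bar> * \<bar>x ^ k * g s x\<bar> \<le> B * C"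
      by (intro mult_mono) (auto intro: order_trans[OF abs_ge_zero])
    then show "\<bar>x ^ k * (f s x * g s x)\<bar> \<le> B * C"
      by (simp add: abs_mult algebra_simps)
  qed
qed

lemma locally_rapid_mult:
  "locally_rapid f \<Longrightarrow> locally_rapid g \<Longrightarrow> locally_rapid (\<lambda>t x. f t x * g t x)"
  by (intro locally_rapid_mult_bounded locally_rapid_imp_bounded)

lemma locally_rapid_cmult: "locally_rapid f \<Longrightarrow> locally_rapid (\<lambda>t x. c * f t x)" for c :: real
  by (rule locally_rapid_mult_bounded) (auto simp: locally_bounded_def)

lemma locally_rapid_add:
  assumes "locally_rapid f" "locally_rapid g"
  shows "locally_rapid (\<lambda>t x. f t x + g t x)"
  unfolding locally_rapid_def
proof (intro allI)
  fix t :: real and k :: nat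
  obtain B where B: "\<forall>\<^sub>F s in nhds t. \<forall>x. \<bar>x ^ k * f s x\<bar> \<le> B"
    using assms(1) by (rule locally_rapidE)
  obtain C where C: "\<forall>\<^sub>F s in nhds t. \<forall>x. \<bar>x ^ k * g s x\<bar> \<le> C"
    using assms(2) by (rule locally_rapidE)
  show "\<exists>C. \<forall>\<^sub>F s in nhds t. \<forall>x. \<bar>x ^ k * (f s x + g s x)\<bar> \<le> C"
  proof (intro exI eventually_mono[OF eventually_conj[OF B C]] allI)
    fix s x :: real
    assume *: "(\<forall>x. \<bar>x ^ k * f s x\<bar> \<le> B) \<and> (\<forall>x. \<bar>x ^ k * g s x\<bar> \<le> C)"
    have "\<bar>x ^ k * (f s x + g s x)\<bar> \<le> \<bar>x ^ k * f s x\<bar> + \<bar>x ^ k * g s x\<bar>"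
      by (simp add: distrib_left)
    also have "\<dots> \<le> B + C"
      using * by (intro add_mono) auto
    finally show "\<bar>x ^ k * (f s x + g s x)\<bar> \<le> B + C" .
  qed
qed

lemma locally_rapid_power_mult:
  assumes "locally_rapid f"
  shows "locally_rapid (\<lambda>t x. x ^ j * f t x)"
  using assms unfolding locally_rapid_def
  by (simp add: mult.assoc[symmetric] power_add[symmetric])

lemmas locally_rapid_intros = locally_rapid_mult locally_rapid_cmult locally_rapid_add
  locally_rapid_power_mult

text \<open>The mean value inequality carries the locally uniform decay of the time derivative over
  to the difference quotients, and dominated convergence along an arbitrary null sequence does the
  rest.\<close>

lemma has_real_derivative_integral:
  fixes f f' :: "real \<Rightarrow> real \<Rightarrow> real"
  assumes deriv: "\<And>s x. ((\<lambda>s. f s x) has_real_derivative f' s x) (at s)"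
    and f: "\<And>s. rapid (f s)" and f': "\<And>s. rapid (f' s)" and loc: "locally_rapid f'"
  shows "((\<lambda>s. \<integral>x. f s x \<partial>lborel) has_real_derivative (\<integral>x. f' t x \<partial>lborel)) (at t)"
proof -
  obtain B where B: "\<forall>\<^sub>F s in nhds t. \<forall>x. \<bar>x ^ 0 * f' s x\<bar> \<le> B"
    using loc by (rule locally_rapidE)
  obtain C where C: "\<forall>\<^sub>F s in nhds t. \<forall>x. \<bar>x ^ 2 * f' s x\<bar> \<le> C"
    using loc by (rule locally_rapidE)
  have "\<forall>\<^sub>F s in nhds t. \<forall>x. \<bar>f' s x\<bar> \<le> (B + C) / (1 + x\<^sup>2)"
    using eventually_conj[OF B C]
    by (rule eventually_mono) (simp add: decay_by_inverse_square)
  then obtain d where "d > 0"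
    and d: "\<And>s x. \<bar>s - t\<bar> < d \<Longrightarrow> \<bar>f' s x\<bar> \<le> (B + C) / (1 + x\<^sup>2)"
    by (auto simp: eventually_nhds_metric dist_real_def)
  have "((\<lambda>h. ((\<integral>x. f (t + h) x \<partial>lborel) - (\<integral>x. f t x \<partial>lborel)) / h)
      \<longlongrightarrow> (\<integral>x. f' t x \<partial>lborel)) (at 0)"
    unfolding tendsto_at_iff_sequentially comp_def
  proof safe
    fix h :: "nat \<Rightarrow> real"
    assume h: "\<forall>i. h i \<in> UNIV - {0}" "h \<longlonglongrightarrow> 0"
    have "\<forall>\<^sub>F i in sequentially. \<bar>h i\<bar> < d"
      using h(2) \<open>d > 0\<close> by (auto dest!: tendstoD[of _ _ _ d] simp: dist_real_def)
    then obtain N where N: "\<And>i. i \<ge> N \<Longrightarrow> \<bar>h i\<bar> < d"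
      by (auto simp: eventually_sequentially)
    \<comment> \<open>Shifting the sequence by \<open>N\<close> keeps all increments below
      \<open>d\<close>, so the majorant is valid for every index.\<close>
    have "(\<lambda>i. \<integral>x. (f (t + h (i + N)) x - f t x) / h (i + N) \<partial>lborel)
        \<longlonglongrightarrow> (\<integral>x. f' t x \<partial>lborel)"
    proof (rule integral_dominated_convergence[where w = "\<lambda>x. (B + C) / (1 + x\<^sup>2)"])
      show "integrable lborel (\<lambda>x::real. (B + C) / (1 + x\<^sup>2))"
        by (rule integrable_lborel_inverse_1_plus_square)
      show "f' t \<in> borel_measurable lborel"
        using rapid_measurable[OF f'] by simp
      show "(\<lambda>x. (f (t + h (i + N)) x - f t x) / h (i + N)) \<in> borel_measurable lborel" for i
        using rapid_measurable[OF f] by simp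
      show "AE x in lborel. (\<lambda>i. (f (t + h (i + N)) x - f t x) / h (i + N)) \<longlonglongrightarrow> f' t x"
      proof (rule AE_I2)
        fix x
        have "((\<lambda>h. (f (t + h) x - f t x) / h) \<longlongrightarrow> f' t x) (at 0)"
          using deriv[where s = t] by (simp add: DERIV_def)
        then have "(\<lambda>i. (f (t + h i) x - f t x) / h i) \<longlonglongrightarrow> f' t x"
          using h unfolding tendsto_at_iff_sequentially comp_def by blast
        then show "(\<lambda>i. (f (t + h (i + N)) x - f t x) / h (i + N)) \<longlonglongrightarrow> f' t x"
          by (rule LIMSEQ_ignore_initial_segment)
      qed
      show "AE x in lborel. norm ((f (t + h (i + N)) x - f t x) / h (i + N)) \<le> (B + C) / (1 + x\<^sup>2)" for i
      proof (rule AE_I2)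
        fix x
        let ?h = "h (i + N)"
        have hd: "\<bar>?h\<bar> < d" "?h \<noteq> 0"
          using N h(1) by auto
        have "\<bar>f (t + ?h) x - f t x\<bar> \<le> (B + C) / (1 + x\<^sup>2) * \<bar>(t + ?h) - t\<bar>"
          unfolding real_norm_def[symmetric]
        proof (rule field_differentiable_bound[of "ball t d"])
          fix s assume "s \<in> ball t d"
          then show "((\<lambda>s. f s x) has_field_derivative f' s x) (at s within ball t d)"
            "norm (f' s x) \<le> (B + C) / (1 + x\<^sup>2)"
            using deriv d[of s x] by (auto simp: dist_real_def abs_minus_commute intro: DERIV_subset)
        qed (use hd \<open>d > 0\<close> in \<open>auto simp: dist_real_def\<close>)
        then show "norm ((f (t + ?h) x - f t x) / ?h) \<le> (B + C) / (1 + x\<^sup>2)"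
          using hd by (simp add: divide_le_eq)
      qed
    qed
    moreover have "(\<integral>x. (f (t + h (i + N)) x - f t x) / h (i + N) \<partial>lborel)
        = ((\<integral>x. f (t + h (i + N)) x \<partial>lborel) - (\<integral>x. f t x \<partial>lborel)) / h (i + N)" for i
      using f by (simp add: rapid_integrable)
    ultimately show "(\<lambda>i. ((\<integral>x. f (t + h i) x \<partial>lborel) - (\<integral>x. f t x \<partial>lborel)) / h i)
        \<longlonglongrightarrow> (\<integral>x. f' t x \<partial>lborel)"
      by (intro LIMSEQ_offset[of "\<lambda>i. ((\<integral>x. f (t + h i) x \<partial>lborel) - (\<integral>x. f t x \<partial>lborel)) / h i" N])
        (simp only:)
  qed
  then show ?thesis
    by (simp add: DERIV_def)
qed

subsection \<open>Curves of Schwartz functions\<close>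

lemma schwartz_has_derivative:
  assumes "schwartz f"
  shows "((deriv ^^ n) f has_real_derivative (deriv ^^ Suc n) f x) (at x)"
  using assms by (simp add: schwartz_def DERIV_deriv_iff_real_differentiable)

lemma schwartz_rapid:
  assumes "schwartz f"
  shows "rapid ((deriv ^^ n) f)"
proof -
  have "continuous_on UNIV ((deriv ^^ n) f)"
    using schwartz_has_derivative[OF assms, of n]
    by (meson DERIV_isCont continuous_at_imp_continuous_on)
  then show ?thesis
    using assms by (simp add: rapid_def schwartz_def)
qed

lemma deriv_funpow_linear_comb:
  fixes f g :: "real \<Rightarrow> real"
  assumes "schwartz f" "schwartz g"
  shows "(deriv ^^ n) (\<lambda>x. c * f x + d * g x) = (\<lambda>x. c * (deriv ^^ n) f x + d * (deriv ^^ n) g x)"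
proof (induction n)
  case (Suc n)
  show ?case
  proof
    fix x
    have "((\<lambda>x. c * (deriv ^^ n) f x + d * (deriv ^^ n) g x) has_real_derivative
        c * (deriv ^^ Suc n) f x + d * (deriv ^^ Suc n) g x) (at x)"
      using assms by (intro DERIV_add DERIV_cmult schwartz_has_derivative)
    then show "(deriv ^^ Suc n) (\<lambda>x. c * f x + d * g x) x
        = c * (deriv ^^ Suc n) f x + d * (deriv ^^ Suc n) g x"
      using Suc.IH by (simp add: DERIV_imp_deriv)
  qed
qed simp

text \<open>Differences and quotients must be known to be Schwartz before their seminorm, a real
  supremum, bounds anything.\<close>

lemma schwartz_linear_comb:
  assumes "schwartz f" "schwartz g"
  shows "schwartz (\<lambda>x. c * f x + d * g x)"
proof -
  have "(\<lambda>x. c * (deriv ^^ n) f x + d * (deriv ^^ n) g x) differentiable at x" for n x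
  proof -
    have "((\<lambda>x. c * (deriv ^^ n) f x + d * (deriv ^^ n) g x) has_real_derivative
        c * (deriv ^^ Suc n) f x + d * (deriv ^^ Suc n) g x) (at x)"
      using assms by (intro DERIV_add DERIV_cmult schwartz_has_derivative)
    then show ?thesis
      using real_differentiable_def by blast
  qed
  moreover have "rapid (\<lambda>x. c * (deriv ^^ n) f x + d * (deriv ^^ n) g x)" for n
    using assms by (intro rapid_intros schwartz_rapid)
  ultimately show ?thesis
    using assms by (simp add: schwartz_def deriv_funpow_linear_comb rapid_def)
qed

lemma schwartz_seminorm_bound:
  assumes "schwartz f"
  shows "\<bar>x ^ k * (deriv ^^ n) f x\<bar> \<le> schwartz_seminorm k n f"
proof -
  obtain C where "\<And>x. \<bar>x ^ k * (deriv ^^ n) f x\<bar> \<le> C"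
    using schwartz_rapid[OF assms, of n] unfolding rapid_def bounded_iff by auto
  then have "bdd_above (range (\<lambda>x. \<bar>x ^ k * (deriv ^^ n) f x\<bar>))"
    by (auto intro: bdd_aboveI[where M = C])
  then show ?thesis
    unfolding schwartz_seminorm_def by (rule cSUP_upper[rotated]) simp
qed

lemma schwartz_deriv_bound:
  assumes "schwartz f"
  obtains C where "\<And>x. \<bar>x ^ k * (deriv ^^ n) f x\<bar> \<le> C"
  using schwartz_seminorm_bound[OF assms] by blast

text \<open>Near t the seminorm of the difference is below 1, so the bound at t holds nearby with 1
  added. The punctured neighbourhood is completed by the bound at t itself.\<close>

lemma locally_rapid_of_schwartz_tendsto:
  assumes v: "\<And>t. schwartz (v t)" and cont: "\<And>t. schwartz_tendsto v (v t) (at t)"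
  shows "locally_rapid (\<lambda>t. (deriv ^^ n) (v t))"
  unfolding locally_rapid_def
proof (intro allI)
  fix t :: real and k :: nat
  obtain C where C: "\<And>x. \<bar>x ^ k * (deriv ^^ n) (v t) x\<bar> \<le> C"
    using schwartz_deriv_bound[OF v] by blast
  have "((\<lambda>s. schwartz_seminorm k n (\<lambda>x. v s x - v t x)) \<longlongrightarrow> 0) (at t)"
    using cont by (simp add: schwartz_tendsto_def)
  then have ev: "\<forall>\<^sub>F s in at t. schwartz_seminorm k n (\<lambda>x. v s x - v t x) < 1"
    by (rule order_tendstoD) simp
  have bound: "\<bar>x ^ k * (deriv ^^ n) (v s) x\<bar> \<le> C + 1"
    if "schwartz_seminorm k n (\<lambda>x. v s x - v t x) < 1" for s x
  proof -
    have eq: "(\<lambda>x. v s x - v t x) = (\<lambda>x. 1 * v s x + (-1) * v t x)"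
      by simp
    have "\<bar>x ^ k * (deriv ^^ n) (\<lambda>x. v s x - v t x) x\<bar> < 1"
      using schwartz_seminorm_bound[OF schwartz_linear_comb[OF v v], of x k n 1 s "-1" t] that
      by simp
    then have "\<bar>x ^ k * (deriv ^^ n) (v s) x - x ^ k * (deriv ^^ n) (v t) x\<bar> < 1"
      unfolding eq deriv_funpow_linear_comb[OF v v] by (simp add: algebra_simps)
    then show ?thesis
      using C[of x] by linarith
  qed
  have "\<forall>\<^sub>F s in at t. \<forall>x. \<bar>x ^ k * (deriv ^^ n) (v s) x\<bar> \<le> C + 1"
    using ev by (rule eventually_mono) (use bound in blast)
  then have "\<forall>\<^sub>F s in nhds t. \<forall>x. \<bar>x ^ k * (deriv ^^ n) (v s) x\<bar> \<le> C + 1"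
    unfolding eventually_at_filter using C
    by (elim eventually_mono) (metis UNIV_I add_increasing2 zero_le_one)
  then show "\<exists>C. \<forall>\<^sub>F s in nhds t. \<forall>x. \<bar>x ^ k * (deriv ^^ n) (v s) x\<bar> \<le> C" ..
qed

lemma difference_quotient_seminorm_bound:
  assumes "schwartz f" "schwartz g" "schwartz v" "h \<noteq> 0"
  shows "\<bar>x ^ k * (((deriv ^^ n) f x - (deriv ^^ n) g x) / h - (deriv ^^ n) v x)\<bar>
    \<le> schwartz_seminorm k n (\<lambda>x. (f x - g x) / h - v x)"
proof -
  have eq: "(\<lambda>x. (f x - g x) / h - v x)
      = (\<lambda>x. 1 * ((1 / h) * f x + (- (1 / h)) * g x) + (-1) * v x)"
    by (simp add: diff_divide_distrib)
  have "schwartz (\<lambda>x. (f x - g x) / h - v x)"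
    unfolding eq by (intro schwartz_linear_comb assms)
  moreover have "(deriv ^^ n) (\<lambda>x. (f x - g x) / h - v x)
      = (\<lambda>x. ((deriv ^^ n) f x - (deriv ^^ n) g x) / h - (deriv ^^ n) v x)"
    unfolding eq using assms
    by (simp only: deriv_funpow_linear_comb schwartz_linear_comb) (simp add: diff_divide_distrib)
  ultimately show ?thesis
    using schwartz_seminorm_bound by metis
qed

text \<open>Turns seminorm convergence into pointwise facts: time differentiation commutes with all
  space derivatives, and all of them decay locally uniformly in time.\<close>

lemma schwartz_C1E:
  assumes "schwartz_C1 u"
  obtains v where "\<And>t. schwartz (u t)" "\<And>t. schwartz (v t)"
    "\<And>n t x. ((\<lambda>s. (deriv ^^ n) (u s) x) has_real_derivative (deriv ^^ n) (v t) x) (at t)"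
    "\<And>n. locally_rapid (\<lambda>t. (deriv ^^ n) (u t))"
    "\<And>n. locally_rapid (\<lambda>t. (deriv ^^ n) (v t))"
proof -
  from assms obtain v where u: "\<And>t. schwartz (u t)" and v: "\<And>t. schwartz (v t)"
    and quot: "\<And>t. schwartz_tendsto (\<lambda>h x. (u (t + h) x - u t x) / h) (v t) (at 0)"
    and cont: "\<And>t. schwartz_tendsto v (v t) (at t)"
    unfolding schwartz_C1_def by blast
  have lim: "((\<lambda>h. schwartz_seminorm k n (\<lambda>x. (u (t + h) x - u t x) / h - v t x)) \<longlongrightarrow> 0) (at 0)"
    for k n t
    using quot by (simp add: schwartz_tendsto_def)
  have deriv: "((\<lambda>s. (deriv ^^ n) (u s) x) has_real_derivative (deriv ^^ n) (v t) x) (at t)" for n t x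
    unfolding DERIV_def
  proof (rule Lim_transform)
    show "((\<lambda>h. (deriv ^^ n) (v t) x) \<longlongrightarrow> (deriv ^^ n) (v t) x) (at 0)"
      by simp
    show "((\<lambda>h. ((deriv ^^ n) (u (t + h)) x - (deriv ^^ n) (u t) x) / h - (deriv ^^ n) (v t) x)
        \<longlongrightarrow> 0) (at 0)"
    proof (rule Lim_null_comparison[OF _ lim[of 0 n t]])
      show "\<forall>\<^sub>F h in at 0.
          norm (((deriv ^^ n) (u (t + h)) x - (deriv ^^ n) (u t) x) / h - (deriv ^^ n) (v t) x)
          \<le> schwartz_seminorm 0 n (\<lambda>x. (u (t + h) x - u t x) / h - v t x)"
        unfolding eventually_at_filter
        using difference_quotient_seminorm_bound[OF u u v, where k = 0 and n = n and x = x]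
        by (intro always_eventually) simp
    qed
  qed
  have "locally_rapid (\<lambda>t. (deriv ^^ n) (u t))" for n
    unfolding locally_rapid_def
  proof (intro allI)
    fix t :: real and k :: nat
    obtain C where C: "\<And>x. \<bar>x ^ k * (deriv ^^ n) (u t) x\<bar> \<le> C"
      using schwartz_deriv_bound[OF u] by blast
    obtain C' where C': "\<And>x. \<bar>x ^ k * (deriv ^^ n) (v t) x\<bar> \<le> C'"
      using schwartz_deriv_bound[OF v] by blast
    \<comment> \<open>u(t+h) is u(t) plus h times the difference quotient, and the quotient is
      within 1 of v(t) in the weighted norm; with |h| < 1 this adds at most C' + 1.\<close>
    have bound: "\<bar>x ^ k * (deriv ^^ n) (u (t + h)) x\<bar> \<le> C + C' + 1"
      if sem: "schwartz_seminorm k n (\<lambda>x. (u (t + h) x - u t x) / h - v t x) < 1"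
        and h: "h \<noteq> 0" "\<bar>h\<bar> < 1" for h x
    proof -
      let ?q = "((deriv ^^ n) (u (t + h)) x - (deriv ^^ n) (u t) x) / h"
      have "\<bar>x ^ k * (?q - (deriv ^^ n) (v t) x)\<bar> < 1"
        using difference_quotient_seminorm_bound[OF u u v h(1), of x k n "t + h" t t] sem by linarith
      then have "\<bar>x ^ k * ?q\<bar> \<le> C' + 1"
        using C'[of x] by (simp only: right_diff_distrib)
      then have "\<bar>h\<bar> * \<bar>x ^ k * ?q\<bar> \<le> C' + 1"
        using h(2) mult_mono[of "\<bar>h\<bar>" 1 "\<bar>x ^ k * ?q\<bar>" "C' + 1"] by simp
      moreover have "h * (x ^ k * ?q)
          = x ^ k * (deriv ^^ n) (u (t + h)) x - x ^ k * (deriv ^^ n) (u t) x"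
        using h(1) by (simp add: field_simps)
      then have "\<bar>h\<bar> * \<bar>x ^ k * ?q\<bar>
          = \<bar>x ^ k * (deriv ^^ n) (u (t + h)) x - x ^ k * (deriv ^^ n) (u t) x\<bar>"
        by (metis abs_mult)
      ultimately have "\<bar>x ^ k * (deriv ^^ n) (u (t + h)) x - x ^ k * (deriv ^^ n) (u t) x\<bar> \<le> C' + 1"
        by (simp only:)
      then show ?thesis
        using C[of x] by linarith
    qed
    have "\<forall>\<^sub>F h in at 0. schwartz_seminorm k n (\<lambda>x. (u (t + h) x - u t x) / h - v t x) < 1"
      using lim by (rule order_tendstoD) simp
    moreover have "\<forall>\<^sub>F h in at 0. h \<noteq> 0 \<and> \<bar>h\<bar> < (1::real)"
      by (auto simp: eventually_at dist_real_def intro!: exI[of _ 1])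
    ultimately have "\<forall>\<^sub>F h in at 0. \<forall>x. \<bar>x ^ k * (deriv ^^ n) (u (t + h)) x\<bar> \<le> C + C' + 1"
      by eventually_elim (use bound in blast)
    then have "\<forall>\<^sub>F s in at t. \<forall>x. \<bar>x ^ k * (deriv ^^ n) (u s) x\<bar> \<le> C + C' + 1"
      by (simp add: eventually_at_to_0[of _ t] add.commute)
    moreover have "C' \<ge> 0"
      using C'[of 0] by (rule order_trans[OF abs_ge_zero])
    then have "\<bar>x ^ k * (deriv ^^ n) (u t) x\<bar> \<le> C + C' + 1" for x
      using C[of x] by linarith
    ultimately have "\<forall>\<^sub>F s in nhds t. \<forall>x. \<bar>x ^ k * (deriv ^^ n) (u s) x\<bar> \<le> C + C' + 1"
      unfolding eventually_at_filter by (elim eventually_mono) auto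
    then show "\<exists>C. \<forall>\<^sub>F s in nhds t. \<forall>x. \<bar>x ^ k * (deriv ^^ n) (u s) x\<bar> \<le> C" ..
  qed
  with u v deriv locally_rapid_of_schwartz_tendsto[OF v cont] show thesis
    using that by blast
qed

subsection \<open>The nonlinearity\<close>

text \<open>Away from 0 the function is plus or minus |r|^p; at 0 its difference quotient is
  |h|^(p-1), which tends to 0 because p > 1.\<close>

lemma has_real_derivative_abs_powr_mult:
  fixes p r :: real
  assumes "p > 1"
  shows "((\<lambda>r. \<bar>r\<bar> powr (p - 1) * r) has_real_derivative p * \<bar>r\<bar> powr (p - 1)) (at r)"
proof -
  consider "r > 0" | "r < 0" | "r = 0"
    by linarith
  then show ?thesis
  proof cases
    case 1
    have "((\<lambda>r. r powr p) has_real_derivative p * r powr (p - 1)) (at r)"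
      using has_real_derivative_powr[OF 1] by simp
    then have "((\<lambda>r. \<bar>r\<bar> powr (p - 1) * r) has_real_derivative p * r powr (p - 1)) (at r)"
    proof (rule has_field_derivative_transform_within_open[of _ _ _ "{0<..}"])
      fix y :: real
      assume "y \<in> {0<..}"
      then show "y powr p = \<bar>y\<bar> powr (p - 1) * y"
        using powr_add[of y "p - 1" 1] by simp
    qed (use 1 in auto)
    then show ?thesis
      using 1 by simp
  next
    case 2
    have "((\<lambda>r. r powr p) has_real_derivative p * (- r) powr (p - 1)) (at (- r))"
      using has_real_derivative_powr[of "- r" p] 2 by simp
    then have "((\<lambda>r. - ((- r) powr p)) has_real_derivative p * (- r) powr (p - 1)) (at r)"
      by (auto intro!: derivative_eq_intros simp: 2)
    then have "((\<lambda>r. \<bar>r\<bar> powr (p - 1) * r) has_real_derivative p * (- r) powr (p - 1)) (at r)"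
    proof (rule has_field_derivative_transform_within_open[of _ _ _ "{..<0}"])
      fix y :: real
      assume "y \<in> {..<0}"
      then show "- ((- y) powr p) = \<bar>y\<bar> powr (p - 1) * y"
        using powr_add[of "- y" "p - 1" 1] by simp
    qed (use 2 in auto)
    then show ?thesis
      using 2 by simp
  next
    case 3
    \<comment> \<open>The limit is 0 because \<open>0 powr x\<close> is 0, which also makes the
      claimed derivative right at r = 0.\<close>
    have "((\<lambda>h. \<bar>h\<bar> powr (p - 1)) \<longlongrightarrow> 0 powr (p - 1)) (at (0::real))"
      using assms by (intro tendsto_powr2 tendsto_rabs_zero tendsto_intros) (auto intro: always_eventually)
    then have "((\<lambda>h. \<bar>h\<bar> powr (p - 1)) \<longlongrightarrow> 0) (at (0::real))"
      by simp
    then have "((\<lambda>h. (\<bar>h\<bar> powr (p - 1) * h) / h) \<longlongrightarrow> 0) (at (0::real))"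
      by (rule Lim_transform_eventually) (auto simp: eventually_at intro!: exI[of _ 1])
    then show ?thesis
      using 3 by (simp add: DERIV_def)
  qed
qed

lemma continuous_on_abs_powr:
  fixes p :: real
  assumes "p > 1" "continuous_on S f"
  shows "continuous_on S (\<lambda>x. \<bar>f x\<bar> powr (p - 1))"
  using assms by (intro continuous_on_powr' continuous_intros) auto

subsection \<open>Conservation laws and moments\<close>

text \<open>Here \<open>w\<close> is the time derivative of u. That \<open>wx\<close> serves both as
  space derivative of \<open>w\<close> and as time derivative of \<open>ux\<close> encodes the
  equality of mixed derivatives. The equation is stated after the chain rule.\<close>

locale gkdv =
  fixes p :: real and u ux uxx uxxx w wx :: "real \<Rightarrow> real \<Rightarrow> real"
  assumes p_gt_1: "p > 1"
    and u_deriv: "\<And>t x. (u t has_real_derivative ux t x) (at x)"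
    and ux_deriv: "\<And>t x. (ux t has_real_derivative uxx t x) (at x)"
    and uxx_deriv: "\<And>t x. (uxx t has_real_derivative uxxx t x) (at x)"
    and w_deriv: "\<And>t x. (w t has_real_derivative wx t x) (at x)"
    and u_time_deriv: "\<And>t x. ((\<lambda>s. u s x) has_real_derivative w t x) (at t)"
    and ux_time_deriv: "\<And>t x. ((\<lambda>s. ux s x) has_real_derivative wx t x) (at t)"
    and rapid: "\<And>t. rapid (u t)" "\<And>t. rapid (ux t)" "\<And>t. rapid (uxx t)"
      "\<And>t. rapid (uxxx t)" "\<And>t. rapid (w t)" "\<And>t. rapid (wx t)"
    and locally_rapid: "locally_rapid u" "locally_rapid ux" "locally_rapid w" "locally_rapid wx"
    and eq: "\<And>t x. w t x = p * \<bar>u t x\<bar> powr (p - 1) * ux t x - uxxx t x"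
begin

text \<open>This weight may fail to be differentiable at zeros of u, so it is never differentiated
  alone, only within \<open>a * u\<close> and multiples of it.\<close>

definition a :: "real \<Rightarrow> real \<Rightarrow> real" where
  "a t x = \<bar>u t x\<bar> powr (p - 1)"

text \<open>The equation is \<open>w = h\<^sub>x\<close>, where \<open>h\<close> is the variational derivative of the energy.\<close>

definition h :: "real \<Rightarrow> real \<Rightarrow> real" where
  "h t x = a t x * u t x - uxx t x"

lemma a_nonneg: "a t x \<ge> 0"
  by (simp add: a_def)

lemma a_bound:
  assumes "\<bar>u t x\<bar> \<le> C"
  shows "\<bar>a t x\<bar> \<le> C powr (p - 1)"
  using assms p_gt_1 by (simp add: a_def powr_mono2)

lemma rapid_a:
  assumes "rapid f"
  shows "rapid (\<lambda>x. a t x * f x)"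
proof (rule rapid_mult_bounded[OF _ _ assms])
  show "continuous_on UNIV (a t)"
    using continuous_on_abs_powr[OF p_gt_1 rapid_continuous[OF rapid(1)]]
    by (simp add: a_def[abs_def])
  obtain C where "\<And>x. \<bar>u t x\<bar> \<le> C"
    using rapid_bounded[OF rapid(1)] by (auto simp: bounded_iff)
  then have "\<And>x. \<bar>a t x\<bar> \<le> C powr (p - 1)"
    by (rule a_bound)
  then show "bounded (range (a t))"
    by (auto simp: bounded_iff)
qed

lemma locally_rapid_a:
  assumes "locally_rapid f"
  shows "locally_rapid (\<lambda>t x. a t x * f t x)"
proof (rule locally_rapid_mult_bounded[OF _ assms])
  show "locally_bounded a"
    unfolding locally_bounded_def
  proof
    fix t
    obtain C where "\<forall>\<^sub>F s in nhds t. \<forall>x. \<bar>u s x\<bar> \<le> C"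
      using locally_rapid_imp_bounded[OF locally_rapid(1)] by (auto simp: locally_bounded_def)
    then have "\<forall>\<^sub>F s in nhds t. \<forall>x. \<bar>a s x\<bar> \<le> C powr (p - 1)"
      by (rule eventually_mono) (auto intro: a_bound)
    then show "\<exists>C. \<forall>\<^sub>F s in nhds t. \<forall>x. \<bar>a s x\<bar> \<le> C" ..
  qed
qed

section \<open>Derivatives of the nonlinear terms\<close>

lemma nonlinearity_deriv:
  "((\<lambda>x. a t x * u t x) has_real_derivative p * (a t x * ux t x)) (at x)"
  using DERIV_chain2[OF has_real_derivative_abs_powr_mult[OF p_gt_1] u_deriv]
  by (simp add: a_def mult.assoc)

lemma nonlinearity_time_deriv:
  "((\<lambda>s. a s x * u s x) has_real_derivative p * (a t x * w t x)) (at t)"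
  using DERIV_chain2[OF has_real_derivative_abs_powr_mult[OF p_gt_1] u_time_deriv]
  by (simp add: a_def mult.assoc)

lemma potential_deriv:
  "((\<lambda>x. a t x * (u t x)\<^sup>2) has_real_derivative (p + 1) * (a t x * u t x * ux t x)) (at x)"
  using DERIV_mult[OF nonlinearity_deriv[of t x] u_deriv[of t x]]
  by (simp add: power2_eq_square algebra_simps)

lemma potential_time_deriv:
  "((\<lambda>s. a s x * (u s x)\<^sup>2) has_real_derivative (p + 1) * (a t x * u t x * w t x)) (at t)"
  using DERIV_mult[OF nonlinearity_time_deriv[of x t] u_time_deriv[of x t]]
  by (simp add: power2_eq_square algebra_simps)

lemma w_eq: "w t x = p * (a t x * ux t x) - uxxx t x"
  by (simp add: eq a_def mult.assoc)

lemma h_deriv: "(h t has_real_derivative w t x) (at x)"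
  unfolding h_def w_eq by (intro DERIV_diff nonlinearity_deriv uxx_deriv)

lemma rapid_h: "rapid (h t)"
  unfolding h_def by (intro rapid_intros rapid_a rapid)

lemmas rapids = rapid_intros rapid_a rapid_h rapid

section \<open>Integral functionals and integration by parts\<close>

definition mass where "mass t = (\<integral>x. (u t x)\<^sup>2 \<partial>lborel)"
definition A where "A t = (\<integral>x. (ux t x)\<^sup>2 \<partial>lborel)"
definition B where "B t = (\<integral>x. a t x * (u t x)\<^sup>2 \<partial>lborel)"
definition K where "K t = (\<integral>x. (uxx t x)\<^sup>2 \<partial>lborel)"
definition N where "N t = (\<integral>x. a t x * (ux t x)\<^sup>2 \<partial>lborel)"
definition P where "P t = (\<integral>x. (a t x * u t x)\<^sup>2 \<partial>lborel)"

definition e :: "real \<Rightarrow> real \<Rightarrow> real" where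
  "e t x = 1/2 * (ux t x)\<^sup>2 + 1/(p + 1) * (a t x * (u t x)\<^sup>2)"

definition energy where "energy t = (\<integral>x. e t x \<partial>lborel)"

lemma rapid_e: "rapid (e t)"
  unfolding e_def by (intro rapids)

lemma energy_eq: "energy t = A t / 2 + B t / (p + 1)"
  by (simp add: energy_def e_def A_def B_def rapid_integrable rapids)

lemma integral_u_uxx: "(\<integral>x. u t x * uxx t x \<partial>lborel) = - A t"
proof -
  have "(\<integral>x. u t x * uxx t x + (ux t x)\<^sup>2 \<partial>lborel) = 0"
    by (rule integral_derivative_eq_0[where F = "\<lambda>x. u t x * ux t x"])
      (auto intro!: derivative_eq_intros u_deriv ux_deriv rapids simp: power2_eq_square)
  then show ?thesis
    by (simp add: A_def rapid_integrable rapids)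
qed

lemma integral_a_u_uxx: "(\<integral>x. a t x * u t x * uxx t x \<partial>lborel) = - (p * N t)"
proof -
  have "(\<integral>x. a t x * u t x * uxx t x + p * (a t x * (ux t x)\<^sup>2) \<partial>lborel) = 0"
  proof (rule integral_derivative_eq_0)
    show "((\<lambda>x. a t x * u t x * ux t x) has_real_derivative
        a t x * u t x * uxx t x + p * (a t x * (ux t x)\<^sup>2)) (at x)" for x
      using DERIV_mult[OF nonlinearity_deriv[of t x] ux_deriv[of t x]]
      by (simp add: power2_eq_square algebra_simps)
  qed (intro rapids)+
  then show ?thesis
    by (simp add: N_def rapid_integrable rapids)
qed

section \<open>Local conservation laws for mass and energy\<close>

text \<open>An antiderivative of 2 u h_x, the time derivative of u^2: integrate by parts once and
  use that u_x h is the derivative of a u^2/(p+1) - u_x^2/2.\<close>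

definition mass_flux :: "real \<Rightarrow> real \<Rightarrow> real" where
  "mass_flux t x = 2 * (u t x * h t x) + (ux t x)\<^sup>2 - 2/(p + 1) * (a t x * (u t x)\<^sup>2)"

text \<open>The time derivative of the energy density is u_x w_x + a u w, which is (u_x w)_x + h w,
  and h w = h h_x.\<close>

definition energy_flux :: "real \<Rightarrow> real \<Rightarrow> real" where
  "energy_flux t x = ux t x * w t x + 1/2 * (h t x)\<^sup>2"

lemma mass_flux_deriv: "(mass_flux t has_real_derivative 2 * (u t x * w t x)) (at x)"
proof -
  have "(mass_flux t has_real_derivative
      2 * (ux t x * h t x + w t x * u t x) + 2 * ux t x * uxx t x
      - 2/(p + 1) * ((p + 1) * (a t x * u t x * ux t x))) (at x)"
    unfolding mass_flux_def using DERIV_power[OF ux_deriv[of t x], where n = 2]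
    by (intro DERIV_diff DERIV_add DERIV_cmult DERIV_mult u_deriv h_deriv potential_deriv)
      (simp_all add: mult_ac)
  moreover have "2/(p + 1) * ((p + 1) * (a t x * u t x * ux t x)) = 2 * (a t x * u t x * ux t x)"
    using p_gt_1 by simp
  ultimately show ?thesis
    by (simp add: h_def algebra_simps)
qed

lemma energy_flux_deriv:
  "(energy_flux t has_real_derivative ux t x * wx t x + a t x * u t x * w t x) (at x)"
proof -
  have "(energy_flux t has_real_derivative
      uxx t x * w t x + wx t x * ux t x + 1/2 * (2 * h t x * w t x)) (at x)"
    unfolding energy_flux_def using DERIV_power[OF h_deriv[of t x], where n = 2]
    by (intro DERIV_add DERIV_cmult DERIV_mult ux_deriv w_deriv) (simp_all add: mult_ac)
  then show ?thesis
    by (simp add: h_def algebra_simps)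
qed

lemma rapid_fluxes: "rapid (mass_flux t)" "rapid (energy_flux t)"
  unfolding mass_flux_def energy_flux_def by (intro rapids)+

lemma integral_u_h: "(\<integral>x. u t x * h t x \<partial>lborel) = A t + B t"
proof -
  have "(\<integral>x. u t x * h t x \<partial>lborel) = (\<integral>x. a t x * (u t x)\<^sup>2 - u t x * uxx t x \<partial>lborel)"
    by (simp add: h_def power2_eq_square algebra_simps)
  then show ?thesis
    by (simp add: B_def integral_u_uxx rapid_integrable rapids)
qed

lemma integral_mass_flux: "(\<integral>x. mass_flux t x \<partial>lborel) = 3 * A t + 2 * p / (p + 1) * B t"
proof -
  have "(\<integral>x. mass_flux t x \<partial>lborel) = 2 * (A t + B t) + A t - 2/(p + 1) * B t"
    unfolding mass_flux_def
    by (simp add: A_def[symmetric] B_def[symmetric] integral_u_h rapid_integrable rapids)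
  also have "\<dots> = 3 * A t + 2 * p / (p + 1) * B t"
    using p_gt_1 by (simp add: field_simps)
  finally show ?thesis .
qed

lemma integral_ux_w: "(\<integral>x. ux t x * w t x \<partial>lborel) = K t + p * N t"
proof -
  have "(\<integral>x. ux t x * w t x + uxx t x * h t x \<partial>lborel) = 0"
    by (rule integral_derivative_eq_0[where F = "\<lambda>x. ux t x * h t x"])
      (auto intro!: derivative_eq_intros h_deriv ux_deriv rapids)
  moreover have "(\<integral>x. uxx t x * h t x \<partial>lborel)
      = (\<integral>x. a t x * u t x * uxx t x - (uxx t x)\<^sup>2 \<partial>lborel)"
    by (simp add: h_def power2_eq_square algebra_simps)
  ultimately show ?thesis
    by (simp add: K_def integral_a_u_uxx rapid_integrable rapids)
qed

lemma integral_h2: "(\<integral>x. (h t x)\<^sup>2 \<partial>lborel) = P t + 2 * p * N t + K t"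
proof -
  have "(\<integral>x. (h t x)\<^sup>2 \<partial>lborel)
      = (\<integral>x. (a t x * u t x)\<^sup>2 - 2 * (a t x * u t x * uxx t x) + (uxx t x)\<^sup>2 \<partial>lborel)"
    by (simp add: h_def power2_eq_square algebra_simps)
  then show ?thesis
    by (simp add: P_def K_def integral_a_u_uxx rapid_integrable rapids)
qed

lemma integral_energy_flux:
  "(\<integral>x. energy_flux t x \<partial>lborel) = 3/2 * K t + 2 * p * N t + 1/2 * P t"
proof -
  have "(\<integral>x. energy_flux t x \<partial>lborel) = (K t + p * N t) + 1/2 * (P t + 2 * p * N t + K t)"
    unfolding energy_flux_def
    by (simp add: integral_ux_w integral_h2 rapid_integrable rapids)
  then show ?thesis
    by (simp add: algebra_simps)
qed

section \<open>Moments, conservation and the motion of the centres\<close>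

definition mass_moment where "mass_moment j t = (\<integral>x. x ^ j * (u t x)\<^sup>2 \<partial>lborel)"
definition energy_moment where "energy_moment j t = (\<integral>x. x ^ j * e t x \<partial>lborel)"

lemma mass_moment_deriv:
  "(mass_moment j has_real_derivative (\<integral>x. x ^ j * (2 * (u t x * w t x)) \<partial>lborel)) (at t)"
  unfolding mass_moment_def
  by (rule has_real_derivative_integral)
    (auto intro!: derivative_eq_intros u_time_deriv rapids locally_rapid_intros locally_rapid)

lemma e_time_deriv:
  "((\<lambda>s. e s x) has_real_derivative ux t x * wx t x + a t x * u t x * w t x) (at t)"
proof -
  have "((\<lambda>s. e s x) has_real_derivative 1/2 * (2 * ux t x * wx t x)
      + 1/(p + 1) * ((p + 1) * (a t x * u t x * w t x))) (at t)"
    unfolding e_def using DERIV_power[OF ux_time_deriv[of x t], where n = 2]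
    by (intro DERIV_add DERIV_cmult potential_time_deriv) (simp add: mult_ac)
  moreover have "1/(p + 1) * ((p + 1) * (a t x * u t x * w t x)) = a t x * u t x * w t x"
    using p_gt_1 by simp
  ultimately show ?thesis
    by simp
qed

lemma energy_moment_deriv:
  "(energy_moment j has_real_derivative
     (\<integral>x. x ^ j * (ux t x * wx t x + a t x * u t x * w t x) \<partial>lborel)) (at t)"
  unfolding energy_moment_def
proof (rule has_real_derivative_integral)
  show "((\<lambda>s. x ^ j * e s x) has_real_derivative
      x ^ j * (ux s x * wx s x + a s x * u s x * w s x)) (at s)" for s x
    by (intro DERIV_cmult e_time_deriv)
qed (intro rapids rapid_e locally_rapid_intros locally_rapid_a locally_rapid)+

text \<open>With f the time derivative of a density and F its flux, weight 1 gives conservation and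
  weight x gives the velocity of the first moment.\<close>

lemma integral_power_0_1_mult_derivative:
  assumes F: "\<And>x. (F has_real_derivative f x) (at x)" and rapid: "rapid F" "rapid f"
  shows "(\<integral>x. x ^ 0 * f x \<partial>lborel) = 0"
    and "(\<integral>x. x ^ 1 * f x \<partial>lborel) = - (\<integral>x. F x \<partial>lborel)"
proof -
  show "(\<integral>x. x ^ 0 * f x \<partial>lborel) = 0"
    using integral_derivative_eq_0[OF assms] by simp
  have "(\<integral>x. F x + x ^ 1 * f x \<partial>lborel) = 0"
  proof (rule integral_derivative_eq_0[where F = "\<lambda>x. x ^ 1 * F x"])
    show "((\<lambda>x. x ^ 1 * F x) has_real_derivative F x + x ^ 1 * f x) (at x)" for x
      by (auto intro!: derivative_eq_intros F)
  qed (intro rapids rapid)+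
  then show "(\<integral>x. x ^ 1 * f x \<partial>lborel) = - (\<integral>x. F x \<partial>lborel)"
    using rapid_integrable[OF rapid(1)] rapid_integrable[OF rapid_power_mult[OF rapid(2), of 1]]
    by simp
qed

lemma mass_conserved: "mass t = mass 0"
proof -
  have "(mass_moment 0 has_real_derivative 0) (at t)" for t
    using mass_moment_deriv[of 0 t]
      integral_power_0_1_mult_derivative(1)[OF mass_flux_deriv rapid_fluxes(1), of t]
    by (simp add: rapids)
  then have "mass_moment 0 t = mass_moment 0 0"
    by (intro DERIV_isconst_all) auto
  then show ?thesis
    by (simp add: mass_moment_def mass_def)
qed

lemma energy_conserved: "energy t = energy 0"
proof -
  have "(energy_moment 0 has_real_derivative 0) (at t)" for t
    using energy_moment_deriv[of 0 t]
      integral_power_0_1_mult_derivative(1)[OF energy_flux_deriv rapid_fluxes(2), of t]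
    by (simp add: rapids)
  then have "energy_moment 0 t = energy_moment 0 0"
    by (intro DERIV_isconst_all) auto
  then show ?thesis
    by (simp add: energy_moment_def energy_def)
qed

lemma mass_center_deriv:
  "(mass_moment 1 has_real_derivative - (3 * A t + 2 * p / (p + 1) * B t)) (at t)"
proof -
  have "rapid (\<lambda>x. 2 * (u t x * w t x))"
    by (intro rapids)
  from integral_power_0_1_mult_derivative(2)[OF mass_flux_deriv rapid_fluxes(1) this]
  show ?thesis
    using mass_moment_deriv[of 1 t] by (simp add: integral_mass_flux)
qed

lemma energy_center_deriv:
  "(energy_moment 1 has_real_derivative - (3/2 * K t + 2 * p * N t + 1/2 * P t)) (at t)"
proof -
  have "rapid (\<lambda>x. ux t x * wx t x + a t x * u t x * w t x)"
    by (intro rapids)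
  from integral_power_0_1_mult_derivative(2)[OF energy_flux_deriv rapid_fluxes(2) this]
  show ?thesis
    using energy_moment_deriv[of 1 t] by (simp add: integral_energy_flux)
qed

end

subsection \<open>Monotone bounded functions\<close>

text \<open>Integrating g over [0, n] bounds \<kappa> times the measure of the part of S there by
  the increment of G, at most 2 b for every n.\<close>

lemma emeasure_le_of_derivative_ge:
  fixes G g :: "real \<Rightarrow> real"
  assumes deriv: "\<And>t. (G has_real_derivative g t) (at t)"
    and nonneg: "\<And>t. g t \<ge> 0" and bound: "\<And>t. \<bar>G t\<bar> \<le> b"
    and S: "S \<in> sets lebesgue" "S \<subseteq> {0<..}" and ge: "\<And>t. t \<in> S \<Longrightarrow> g t \<ge> \<kappa>" and "\<kappa> > 0"
  shows "emeasure lebesgue S \<le> ennreal (2 * b / \<kappa>)"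
proof -
  \<comment> \<open>Truncation makes the measure finite, so that real-valued integrals can be
    compared; monotone limits recover S.\<close>
  define T where "T n = S \<inter> {0..real n}" for n :: nat
  have "emeasure lebesgue (T n) \<le> ennreal (2 * b / \<kappa>)" for n
  proof -
    have lm: "T n \<in> lmeasurable"
      unfolding T_def using S(1) by (intro bounded_set_imp_lmeasurable) (auto intro: bounded_Int)
    then have "(indicat_real (T n) has_integral measure lebesgue (T n)) UNIV"
      by (simp add: lmeasurable_iff_has_integral)
    then have "((\<lambda>t. if t \<in> {0..real n} then indicat_real (T n) t else 0)
        has_integral measure lebesgue (T n)) UNIV"
      by (rule has_integral_eq[rotated]) (auto simp: T_def indicator_def)
    then have "(indicat_real (T n) has_integral measure lebesgue (T n)) {0..real n}"
      by (simp only: has_integral_restrict_UNIV)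
    then have 1: "((\<lambda>t. \<kappa> * indicat_real (T n) t) has_integral \<kappa> * measure lebesgue (T n)) {0..real n}"
      by (rule has_integral_mult_right)
    have 2: "(g has_integral G (real n) - G 0) {0..real n}"
      by (rule fundamental_theorem_of_calculus)
        (auto simp: has_real_derivative_iff_has_vector_derivative[symmetric]
          intro: DERIV_subset[OF deriv])
    have "\<kappa> * measure lebesgue (T n) \<le> G (real n) - G 0"
      by (rule has_integral_le[OF 1 2]) (auto simp: T_def indicator_def ge nonneg)
    also have "\<dots> \<le> 2 * b"
      using bound[of "real n"] bound[of 0] by linarith
    finally have "measure lebesgue (T n) \<le> 2 * b / \<kappa>"
      using \<open>\<kappa> > 0\<close> by (simp add: field_simps)
    then show ?thesis
      using lm by (simp add: emeasure_eq_measure2 ennreal_leI)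
  qed
  moreover have "(SUP n. emeasure lebesgue (T n)) = emeasure lebesgue (\<Union>n. T n)"
    using S(1) by (intro SUP_emeasure_incseq) (auto simp: T_def incseq_def)
  moreover have "(\<Union>n. T n) = S"
    using S(2) real_arch_simple by (fastforce simp: T_def)
  ultimately show ?thesis
    by (metis SUP_least)
qed

subsection \<open>The energy moves to the left of the mass\<close>

text \<open>Mass and energy as functions of the datum alone, so that the final constant can be named
  before a solution is chosen.\<close>

definition gkdv_mass :: "(real \<Rightarrow> real) \<Rightarrow> real" where
  "gkdv_mass f = (\<integral>x. (f x)\<^sup>2 \<partial>lborel)"

definition gkdv_energy :: "real \<Rightarrow> (real \<Rightarrow> real) \<Rightarrow> real" where
  "gkdv_energy p f =
     (\<integral>x. 1/2 * (deriv f x)\<^sup>2 + 1/(p + 1) * (\<bar>f x\<bar> powr (p - 1) * (f x)\<^sup>2) \<partial>lborel)"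

text \<open>This is 1/2 - 2 p/(p+1)^2, the coefficient of B^2 left after subtracting the energy term
  from the Cauchy-Schwarz bound.\<close>

definition virial_coeff :: "real \<Rightarrow> real" where
  "virial_coeff p = (p - 1)\<^sup>2 / (2 * (p + 1)\<^sup>2)"

text \<open>The numerator is the lower bound for D' stripped of its power of z. The denominator is
  1, plus a z-free cap for that lower bound, plus the error constant of
  \<open>D_bound\<close>.\<close>

definition sublevel_rate :: "real \<Rightarrow> real \<Rightarrow> real \<Rightarrow> real" where
  "sublevel_rate p M E = virial_coeff p * (M\<^sup>2 / 16) * (M\<^sup>2 / 8) powr (p - 1)
     / (1 + virial_coeff p * ((p + 1) * E)\<^sup>2 + (2 * p + 6) * E\<^sup>2)"

context gkdv
begin

text \<open>This is D', with mass and energy taken at time t so that it can be estimated at a single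
  time.\<close>

definition Q where
  "Q t = mass t * (3/2 * K t + 2 * p * N t + 1/2 * P t)
     - energy t * (3 * A t + 2 * p / (p + 1) * B t)"

text \<open>This is the mass times the energy times the distance of the centre of energy to the left
  of the centre of mass.\<close>

definition D where
  "D t = energy 0 * mass_moment 1 t - mass 0 * energy_moment 1 t"

lemma D_deriv: "(D has_real_derivative Q t) (at t)"
proof -
  have "(D has_real_derivative energy 0 * (- (3 * A t + 2 * p / (p + 1) * B t))
      - mass 0 * (- (3/2 * K t + 2 * p * N t + 1/2 * P t))) (at t)"
    unfolding D_def by (intro DERIV_diff DERIV_cmult mass_center_deriv energy_center_deriv)
  then show ?thesis
    by (simp add: Q_def mass_conserved[of t] energy_conserved[of t] algebra_simps)
qed

lemma functionals_nonneg: "A t \<ge> 0" "B t \<ge> 0" "K t \<ge> 0" "N t \<ge> 0" "P t \<ge> 0" "mass t \<ge> 0"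
  by (auto simp: A_def B_def K_def N_def P_def mass_def a_nonneg intro!: integral_nonneg_AE)

lemma energy_nonneg: "energy t \<ge> 0"
  using p_gt_1 functionals_nonneg by (simp add: energy_eq)

text \<open>The weight \<open>\<surd>3\<close> makes the coefficients of \<open>K\<close> and \<open>P\<close> match those in \<^term>\<open>Q\<close>; the
  condition on \<open>p\<close> is then what makes the coefficient of \<open>A B\<close> nonnegative.\<close>

lemma Q_lower_bound:
  assumes "p \<ge> sqrt 3"
  shows "Q t \<ge> virial_coeff p * (B t)\<^sup>2"
proof -
  define s where "s = sqrt 3"
  have s2: "s\<^sup>2 = 3" and s: "1 < s" "s \<le> 2"
    by (auto simp: s_def intro: real_le_lsqrt real_less_rsqrt)
  let ?g = "\<lambda>x. a t x * u t x - s * uxx t x"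
  have "(\<integral>x. u t x * ?g x \<partial>lborel) = (\<integral>x. a t x * (u t x)\<^sup>2 - s * (u t x * uxx t x) \<partial>lborel)"
    by (simp add: power2_eq_square algebra_simps)
  also have "\<dots> = B t + s * A t"
    by (simp add: B_def integral_u_uxx rapid_integrable rapids)
  finally have 1: "(\<integral>x. u t x * ?g x \<partial>lborel) = B t + s * A t" .
  have "(\<integral>x. (?g x)\<^sup>2 \<partial>lborel) = (\<integral>x. (a t x * u t x)\<^sup>2 - (2 * s) * (a t x * u t x * uxx t x)
      + s\<^sup>2 * (uxx t x)\<^sup>2 \<partial>lborel)"
    by (simp add: power2_eq_square algebra_simps)
  also have "\<dots> = P t + 2 * s * (p * N t) + 3 * K t"
    by (simp add: P_def K_def integral_a_u_uxx s2 rapid_integrable rapids)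
  finally have 2: "(\<integral>x. (?g x)\<^sup>2 \<partial>lborel) = P t + 2 * s * (p * N t) + 3 * K t" .
  have "(\<integral>x. u t x * ?g x \<partial>lborel)\<^sup>2 \<le> mass t * (\<integral>x. (?g x)\<^sup>2 \<partial>lborel)"
    unfolding mass_def by (intro Cauchy_Schwarz_lborel rapids)
  then have CS: "3/2 * (A t)\<^sup>2 + s * (A t * B t) + 1/2 * (B t)\<^sup>2
      \<le> mass t * (3/2 * K t + s * (p * N t) + 1/2 * P t)"
    unfolding 1 2 by (simp add: power2_sum power_mult_distrib s2 algebra_simps)
  \<comment> \<open>The N term comes out with sqrt 3 p instead of 2 p, and sqrt 3 \<le> 2 absorbs
    the difference.\<close>
  have "s * (p * N t) \<le> 2 * (p * N t)"
    using s p_gt_1 functionals_nonneg by (intro mult_right_mono) auto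
  then have "mass t * (3/2 * K t + s * (p * N t) + 1/2 * P t)
      \<le> mass t * (3/2 * K t + 2 * p * N t + 1/2 * P t)"
    using functionals_nonneg by (intro mult_left_mono) auto
  with CS have "Q t \<ge> 3/2 * (A t)\<^sup>2 + s * (A t * B t) + 1/2 * (B t)\<^sup>2
      - energy t * (3 * A t + 2 * p / (p + 1) * B t)"
    by (simp add: Q_def)
  \<comment> \<open>Since the energy is A/2 + B/(p+1), the A^2 terms cancel exactly, leaving only A
    B and B^2.\<close>
  also have "3/2 * (A t)\<^sup>2 + s * (A t * B t) + 1/2 * (B t)\<^sup>2
      - energy t * (3 * A t + 2 * p / (p + 1) * B t)
      = (s - (p + 3) / (p + 1)) * (A t * B t) + virial_coeff p * (B t)\<^sup>2"
  proof -
    define r where "r = 1 / (p + 1)"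
    have r: "p * r = 1 - r"
      using p_gt_1 by (simp add: r_def field_simps)
    have eqs: "2 * p / (p + 1) = 2 - 2 * r" "(p + 3) / (p + 1) = 1 + 2 * r" "B t / (p + 1) = r * B t"
      using p_gt_1 by (simp_all add: r_def field_simps)
    have vc: "virial_coeff p = 1/2 * (1 - 2 * r)\<^sup>2"
      using p_gt_1 by (simp add: r_def virial_coeff_def divide_simps)
    then show ?thesis
      unfolding energy_eq eqs vc by (simp add: power2_eq_square field_simps)
  qed
  finally have "Q t \<ge> (s - (p + 3) / (p + 1)) * (A t * B t) + virial_coeff p * (B t)\<^sup>2" .
  moreover have "(s - (p + 3) / (p + 1)) * (A t * B t) \<ge> 0"
  proof -
    \<comment> \<open>With s = sqrt 3, nonnegativity of the A B coefficient reads (s - 1)(p + 1)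
      \<ge> 2, with equality at p = s.\<close>
    have "(s - 1) * (p + 1) \<ge> (s - 1) * (s + 1)"
      using assms s by (intro mult_left_mono) (auto simp: s_def)
    moreover have "(s - 1) * (s + 1) = 2"
      using s2 by (simp add: power2_eq_square algebra_simps)
    ultimately have "s \<ge> (p + 3) / (p + 1)"
      using p_gt_1 by (simp add: field_simps)
    then show ?thesis
      using functionals_nonneg by simp
  qed
  ultimately show ?thesis
    by linarith
qed

lemma virial_coeff_pos: "virial_coeff p > 0"
  using p_gt_1 by (simp add: virial_coeff_def)

lemma Q_nonneg:
  assumes "p \<ge> sqrt 3"
  shows "Q t \<ge> 0"
  using Q_lower_bound[OF assms, of t] virial_coeff_pos
  by (meson less_imp_le mult_nonneg_nonneg order_trans zero_le_power2)

lemma B_le_energy: "B t \<le> (p + 1) * energy t"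
  using p_gt_1 functionals_nonneg[of t] by (simp add: energy_eq field_simps)

subsection \<open>The interaction functional\<close>

lemma mass_moment_0: "mass_moment 0 t = mass t"
  by (simp add: mass_moment_def mass_def)

lemma integral_shifted_square:
  "(\<integral>x. ((x - c) * u t x)\<^sup>2 \<partial>lborel)
    = mass_moment 2 t - 2 * c * mass_moment 1 t + c\<^sup>2 * mass t"
proof -
  have "(\<integral>x. ((x - c) * u t x)\<^sup>2 \<partial>lborel)
      = (\<integral>x. x ^ 2 * (u t x)\<^sup>2 - (2 * c) * (x ^ 1 * (u t x)\<^sup>2) + c\<^sup>2 * (u t x)\<^sup>2 \<partial>lborel)"
    by (simp add: power2_eq_square algebra_simps)
  also have "\<dots> = mass_moment 2 t - 2 * c * mass_moment 1 t + c\<^sup>2 * mass t"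
    unfolding mass_moment_def mass_def
    by (subst Bochner_Integration.integral_add Bochner_Integration.integral_diff,
        (intro rapid_integrable rapids)+)+ simp
  finally show ?thesis .
qed

lemma interaction_eq:
  "interaction (u t) = 2 * mass t * mass_moment 2 t - 2 * (mass_moment 1 t)\<^sup>2"
proof -
  have "(\<integral>x. (u t x)\<^sup>2 * (x - y)\<^sup>2 * (u t y)\<^sup>2 \<partial>lborel)
      = mass_moment 2 t * (u t y)\<^sup>2 - (2 * mass_moment 1 t) * (y ^ 1 * (u t y)\<^sup>2)
        + mass t * (y ^ 2 * (u t y)\<^sup>2)" for y
  proof -
    have "(\<integral>x. (u t x)\<^sup>2 * (x - y)\<^sup>2 * (u t y)\<^sup>2 \<partial>lborel)
        = (\<integral>x. ((x - y) * u t x)\<^sup>2 \<partial>lborel) * (u t y)\<^sup>2"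
      by (simp add: power_mult_distrib mult.commute)
    then show ?thesis
      unfolding integral_shifted_square by (simp add: algebra_simps)
  qed
  then have "interaction (u t) = (\<integral>y. mass_moment 2 t * (u t y)\<^sup>2
      - (2 * mass_moment 1 t) * (y ^ 1 * (u t y)\<^sup>2) + mass t * (y ^ 2 * (u t y)\<^sup>2) \<partial>lborel)"
    by (simp only: interaction_def)
  also have "\<dots> = mass_moment 2 t * mass t - (2 * mass_moment 1 t) * mass_moment 1 t
      + mass t * mass_moment 2 t"
    unfolding mass_moment_def[of 1] mass_moment_def[of 2] mass_def
    by (subst Bochner_Integration.integral_add Bochner_Integration.integral_diff,
        (intro rapid_integrable rapids)+)+ simp
  finally show ?thesis
    by (simp add: power2_eq_square)
qed

text \<open>Makes the sublevel sets in time closed, hence measurable.\<close>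

lemma interaction_continuous: "continuous_on UNIV (\<lambda>t. interaction (u t))"
proof -
  have "continuous_on UNIV (mass_moment j)" for j
    using mass_moment_deriv DERIV_isCont by (blast intro: continuous_at_imp_continuous_on)
  then show ?thesis
    unfolding interaction_eq mass_moment_0[symmetric] by (intro continuous_intros)
qed

section \<open>Variance about the centre of mass\<close>

definition center where "center t = mass_moment 1 t / mass t"

text \<open>The identity that the mean of (X - Y)^2 is twice the variance, for independent X, Y with
  density u^2 / mass.\<close>

lemma interaction_eq_variance:
  assumes "mass t > 0"
  shows "interaction (u t) = 2 * mass t * (\<integral>x. ((x - center t) * u t x)\<^sup>2 \<partial>lborel)"
  unfolding integral_shifted_square interaction_eq center_def
  using assms by (simp add: field_simps power2_eq_square)

text \<open>Integrating by parts moves both derivatives in the energy density to one factor, so that the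
  other factor is only \<open>(x - c) u\<close>.\<close>

lemma D_eq:
  assumes "mass t > 0"
  shows "D t = - (mass t * (\<integral>x. ((x - center t) * u t x)
    * (1/(p + 1) * (a t x * u t x) - 1/2 * uxx t x) \<partial>lborel))"
proof -
  define c where "c = center t"
  have c: "mass t * c = mass_moment 1 t"
    using assms by (simp add: c_def center_def)
  have "(\<integral>x. (x - c) * ((ux t x)\<^sup>2 + u t x * uxx t x) \<partial>lborel) = 0"
  proof (rule integral_derivative_eq_0)
    \<comment> \<open>Subtracting u^2/2 cancels the u u_x that arises from differentiating the
      weight x - c.\<close>
    show "((\<lambda>x. (x - c) * (u t x * ux t x) - 1/2 * (u t x)\<^sup>2) has_real_derivative
        (x - c) * ((ux t x)\<^sup>2 + u t x * uxx t x)) (at x)" for x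
      by (auto intro!: derivative_eq_intros u_deriv ux_deriv simp: power2_eq_square algebra_simps)
  qed (intro rapids)+
  moreover have "(\<integral>x. (x - c) * e t x \<partial>lborel)
      = (\<integral>x. 1/2 * ((x - c) * ((ux t x)\<^sup>2 + u t x * uxx t x))
        + ((x - c) * u t x) * (1/(p + 1) * (a t x * u t x) - 1/2 * uxx t x) \<partial>lborel)"
    by (rule Bochner_Integration.integral_cong)
      (simp_all add: e_def power2_eq_square algebra_simps add_divide_distrib diff_divide_distrib)
  moreover have "\<dots> = 1/2 * (\<integral>x. (x - c) * ((ux t x)\<^sup>2 + u t x * uxx t x) \<partial>lborel)
      + (\<integral>x. ((x - c) * u t x) * (1/(p + 1) * (a t x * u t x) - 1/2 * uxx t x) \<partial>lborel)"
    by (subst Bochner_Integration.integral_add, (intro rapid_integrable rapids)+) simp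
  moreover have "(\<integral>x. (x - c) * e t x \<partial>lborel) = (\<integral>x. x ^ 1 * e t x - c * e t x \<partial>lborel)"
    by (simp add: algebra_simps)
  moreover have "\<dots> = energy_moment 1 t - c * energy t"
    unfolding energy_moment_def energy_def
    by (subst Bochner_Integration.integral_diff, (intro rapid_integrable rapids rapid_e)+) simp
  ultimately have *: "(\<integral>x. ((x - c) * u t x) * (1/(p + 1) * (a t x * u t x) - 1/2 * uxx t x) \<partial>lborel)
      = energy_moment 1 t - c * energy t"
    by simp
  \<comment> \<open>By the choice of c, D is minus the mass times the first energy moment about
    c.\<close>
  show ?thesis
    unfolding c_def[symmetric] * D_def mass_conserved[of t, symmetric] energy_conserved[of t, symmetric]
      c[symmetric]
    by (simp add: algebra_simps)
qed

text \<open>Cauchy-Schwarz separates the variance, which is the interaction up to the factor 2 mass,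
  from the norm of g. The positive part of \<open>Q\<close> controls the latter, and the negative
  part is at most a multiple of the squared energy.\<close>

lemma D_bound:
  assumes "mass t > 0"
  shows "(D t)\<^sup>2 \<le> interaction (u t) * (Q t + (2 * p + 6) * (energy t)\<^sup>2)"
proof -
  define J where "J = (\<integral>x. ((x - center t) * u t x)\<^sup>2 \<partial>lborel)"
  define r where "r = 1/(p + 1)"
  define g where "g x = r * (a t x * u t x) - 1/2 * uxx t x" for x
  have r: "0 < r" "r \<le> 1/2"
    using p_gt_1 by (auto simp: r_def field_simps)
  have rapids_g: "rapid g" "rapid (\<lambda>x. (x - center t) * u t x)"
    unfolding g_def by (intro rapids)+
  have "J \<ge> 0"
    by (simp add: J_def)
  have "(\<integral>x. (g x)\<^sup>2 \<partial>lborel) = (\<integral>x. r\<^sup>2 * (a t x * u t x)\<^sup>2 - r * (a t x * u t x * uxx t x)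
      + 1/4 * (uxx t x)\<^sup>2 \<partial>lborel)"
    by (simp add: g_def power2_eq_square algebra_simps add_divide_distrib
        diff_divide_distrib)
  also have "\<dots> = r\<^sup>2 * P t + r * (p * N t) + 1/4 * K t"
    by (simp add: P_def K_def integral_a_u_uxx rapid_integrable rapids)
  \<comment> \<open>The coefficients of P, N and K are each at most those of the energy
    flux.\<close>
  also have "\<dots> \<le> 1/2 * P t + 2 * (p * N t) + 3/2 * K t"
  proof (intro add_mono mult_right_mono)
    show "r\<^sup>2 \<le> 1/2"
      using power_mono[of r "1/2" 2] r by (simp add: power2_eq_square)
  qed (use r functionals_nonneg p_gt_1 in auto)
  also have "\<dots> = 3/2 * K t + 2 * p * N t + 1/2 * P t"
    by simp
  finally have "mass t * (\<integral>x. (g x)\<^sup>2 \<partial>lborel) \<le> mass t * (3/2 * K t + 2 * p * N t + 1/2 * P t)"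
    using assms by (intro mult_left_mono) auto
  also have "\<dots> \<le> Q t + (2 * p + 6) * (energy t)\<^sup>2"
  proof -
    \<comment> \<open>Relative to the energy A/2 + B/(p+1) the two coefficients are 6 and 2 p; their
      sum dominates both.\<close>
    have "3 * A t + 2 * p / (p + 1) * B t \<le> (2 * p + 6) * (A t / 2 + B t / (p + 1))"
    proof -
      have "0 \<le> p * A t + 6 * (B t / (p + 1))"
        using p_gt_1 functionals_nonneg[of t] by simp
      then show ?thesis
        by (simp add: algebra_simps add_divide_distrib)
    qed
    then have "energy t * (3 * A t + 2 * p / (p + 1) * B t) \<le> energy t * ((2 * p + 6) * energy t)"
      unfolding energy_eq[symmetric] using energy_nonneg by (intro mult_left_mono)
    then show ?thesis
      by (simp add: Q_def power2_eq_square algebra_simps)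
  qed
  finally have g2: "mass t * (\<integral>x. (g x)\<^sup>2 \<partial>lborel) \<le> Q t + (2 * p + 6) * (energy t)\<^sup>2" .
  have "(D t)\<^sup>2 = (mass t)\<^sup>2 * (\<integral>x. ((x - center t) * u t x) * g x \<partial>lborel)\<^sup>2"
    unfolding D_eq[OF assms] g_def r_def by (simp add: power_mult_distrib)
  also have "\<dots> \<le> (mass t)\<^sup>2 * (J * (\<integral>x. (g x)\<^sup>2 \<partial>lborel))"
    unfolding J_def by (intro mult_left_mono Cauchy_Schwarz_lborel rapids_g) simp
  also have "\<dots> = (mass t * J) * (mass t * (\<integral>x. (g x)\<^sup>2 \<partial>lborel))"
    by (simp add: power2_eq_square)
  also have "\<dots> \<le> (2 * mass t * J) * (Q t + (2 * p + 6) * (energy t)\<^sup>2)"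
    using assms \<open>J \<ge> 0\<close> by (intro mult_mono g2) auto
  finally show ?thesis
    by (simp add: interaction_eq_variance[OF assms] J_def)
qed

text \<open>If the interaction is at most \<open>z\<close>, then half of the mass lies within distance \<open>R = \<surd>z / M\<close> of
  the centre, and the choice of \<open>l\<close> ensures that at most
  a quarter of the mass lies there with \<open>u\<^sup>2 < l\<close>.\<close>

lemma potential_lower_bound:
  assumes mass: "mass t > 0" and "z > 0" and I: "interaction (u t) \<le> z"
  shows "((mass t)\<^sup>2 / (8 * sqrt z)) powr ((p - 1) / 2) * (mass t / 4) \<le> B t"
proof -
  define c where "c = center t"
  define J where "J = (\<integral>x. ((x - c) * u t x)\<^sup>2 \<partial>lborel)"
  define R where "R = sqrt z / mass t"
  define l where "l = (mass t)\<^sup>2 / (8 * sqrt z)"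
  define L where "L = l powr ((p - 1) / 2)"
  have pos: "R > 0" "l > 0" "L > 0"
    using assms by (auto simp: R_def l_def L_def)
  \<comment> \<open>A minorant of a u^2 that is easy to integrate: the weighted square outweighs u^2
    outside the interval, the indicator does so where u^2 < l inside it, and elsewhere a \<ge>
    L.\<close>
  let ?f = "\<lambda>x. L * (u t x)\<^sup>2 - (L * l) * indicator {c - R..c + R} x
    - (L / R\<^sup>2) * ((x - c) * u t x)\<^sup>2"
  have ptw: "?f x \<le> a t x * (u t x)\<^sup>2" for x
  proof -
    have au: "a t x * (u t x)\<^sup>2 \<ge> 0"
      by (simp add: a_nonneg)
    have sq: "(L / R\<^sup>2) * ((x - c) * u t x)\<^sup>2 \<ge> 0"
      using pos by simp
    consider "x \<notin> {c - R..c + R}" | "x \<in> {c - R..c + R}" "(u t x)\<^sup>2 < l" | "(u t x)\<^sup>2 \<ge> l"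
      by linarith
    then show ?thesis
    proof cases
      case 1
      then have "R\<^sup>2 \<le> (x - c)\<^sup>2"
        using pos by (subst abs_le_square_iff[symmetric]) auto
      then have "L * (u t x)\<^sup>2 * R\<^sup>2 \<le> L * (u t x)\<^sup>2 * (x - c)\<^sup>2"
        using pos by (intro mult_left_mono) auto
      then have "L * (u t x)\<^sup>2 \<le> (L / R\<^sup>2) * ((x - c) * u t x)\<^sup>2"
        unfolding power_mult_distrib using pos by (simp add: field_simps)
      then show ?thesis
        using 1 au by simp
    next
      case 2
      then have "L * (u t x)\<^sup>2 \<le> L * l"
        using pos by simp
      then show ?thesis
        using 2(1) au sq by simp
    next
      case 3
      have "\<bar>u t x\<bar> = sqrt ((u t x)\<^sup>2)"
        by simp
      also have "\<dots> = (u t x)\<^sup>2 powr (1/2)"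
        by (simp add: powr_half_sqrt)
      finally have "a t x = ((u t x)\<^sup>2 powr (1/2)) powr (p - 1)"
        by (simp only: a_def)
      also have "\<dots> = (u t x)\<^sup>2 powr ((p - 1) / 2)"
        by (simp only: powr_powr) simp
      also have "\<dots> \<ge> L"
        unfolding L_def using 3 pos p_gt_1 by (intro powr_mono2) auto
      finally have "L * (u t x)\<^sup>2 \<le> a t x * (u t x)\<^sup>2"
        by (intro mult_right_mono) auto
      moreover have "(L * l) * indicator {c - R..c + R} x \<ge> 0"
        using pos by simp
      ultimately show ?thesis
        using sq by linarith
    qed
  qed
  have "integrable lborel (indicat_real {c - R..c + R})"
    using pos by (intro integrable_real_indicator) auto
  then have int: "integrable lborel (\<lambda>x. (L * l) * indicat_real {c - R..c + R} x)"
    by simp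
  have int': "integrable lborel (\<lambda>x. L * (u t x)\<^sup>2)"
      "integrable lborel (\<lambda>x. (L / R\<^sup>2) * ((x - c) * u t x)\<^sup>2)"
      "integrable lborel (\<lambda>x. a t x * (u t x)\<^sup>2)"
    by (intro rapid_integrable rapids)+
  have "(\<integral>x. ?f x \<partial>lborel) \<le> B t"
    unfolding B_def by (intro integral_mono Bochner_Integration.integrable_diff int int' ptw)
  also have "(\<integral>x. ?f x \<partial>lborel) = L * mass t - (L * l) * (2 * R) - (L / R\<^sup>2) * J"
    using pos
    by (subst Bochner_Integration.integral_diff, (intro Bochner_Integration.integrable_diff int int')+,
        subst Bochner_Integration.integral_diff, (intro int int')+) (simp add: mass_def J_def)
  finally have "L * (mass t - l * (2 * R) - J / R\<^sup>2) \<le> B t"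
    by (simp add: algebra_simps)
  moreover have "mass t / 4 \<le> mass t - l * (2 * R) - J / R\<^sup>2"
  proof -
    have "l * (2 * R) = mass t / 4"
      using assms by (simp add: l_def R_def field_simps power2_eq_square)
    moreover have "J / R\<^sup>2 \<le> mass t / 2"
    proof -
      have "2 * mass t * J \<le> z"
        using I by (simp add: interaction_eq_variance[OF mass] J_def c_def)
      then have "mass t * (2 * mass t * J) \<le> mass t * z"
        using mass by (intro mult_left_mono) auto
      then show ?thesis
        using assms by (simp add: R_def power_divide field_simps power2_eq_square)
    qed
    ultimately show ?thesis
      by linarith
  qed
  then have "L * (mass t / 4) \<le> L * (mass t - l * (2 * R) - J / R\<^sup>2)"
    using pos by (intro mult_left_mono) auto
  ultimately have "L * (mass t / 4) \<le> B t"
    by linarith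
  then show ?thesis
    by (simp only: L_def l_def)
qed

section \<open>Growth of the arctangent on sublevel sets\<close>

lemma sublevel_rate_pos: "M > 0 \<Longrightarrow> sublevel_rate p M E > 0"
  unfolding sublevel_rate_def using virial_coeff_pos p_gt_1
  by (intro divide_pos_pos mult_pos_pos add_pos_nonneg) auto

text \<open>Since x / (1 + x + C) increases in x, the lower bound q for \<open>Q\<close> may replace
  \<open>Q\<close> in numerator and denominator at once.\<close>

lemma arctan_rate_bound:
  assumes p: "p \<ge> sqrt 3" and mass: "mass t > 0" and z: "z > 0" "interaction (u t) \<le> z"
  shows "sublevel_rate p (mass t) (energy t) * z powr (- p / 2)
    \<le> inverse (1 + (D t / sqrt z)\<^sup>2) * (Q t / sqrt z)"
proof -
  define \<mu> where "\<mu> = virial_coeff p"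
  define M where "M = mass t"
  define b where "b = (M\<^sup>2 / (8 * sqrt z)) powr ((p - 1) / 2) * (M / 4)"
  define C where "C = (2 * p + 6) * (energy t)\<^sup>2"
  define q where "q = \<mu> * b\<^sup>2"
  define q1 where "q1 = \<mu> * ((p + 1) * energy t)\<^sup>2"
  have \<mu>: "\<mu> > 0"
    using virial_coeff_pos by (simp add: \<mu>_def)
  have b: "0 < b" "b \<le> B t"
    using potential_lower_bound[OF mass z] mass z by (auto simp: b_def M_def)
  have "C \<ge> 0"
    using p_gt_1 by (simp add: C_def)
  have "q \<ge> 0"
    using \<mu> by (simp add: q_def)
  have "q \<le> \<mu> * (B t)\<^sup>2"
    unfolding q_def using b \<mu> by (intro mult_left_mono power_mono) auto
  also have "\<dots> \<le> Q t"
    unfolding \<mu>_def by (rule Q_lower_bound[OF p])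
  finally have qQ: "q \<le> Q t" .
  have "q \<le> q1"
    unfolding q_def q1_def using b \<mu> B_le_energy[of t] by (intro mult_left_mono power_mono) auto
  have "(D t)\<^sup>2 \<le> interaction (u t) * (Q t + C)"
    unfolding C_def by (rule D_bound[OF mass])
  also have "\<dots> \<le> z * (Q t + C)"
    using z qQ \<open>q \<ge> 0\<close> \<open>C \<ge> 0\<close> by (intro mult_right_mono) auto
  finally have D: "(D t / sqrt z)\<^sup>2 \<le> Q t + C"
    using z by (simp add: power_divide field_simps)
  \<comment> \<open>q depends on z, so the denominator uses q1 instead, a bound through the energy;
    only then is the rate a pure power of z.\<close>
  have "q / (1 + q1 + C) \<le> q / (1 + q + C)"
    using \<open>q \<le> q1\<close> \<open>q \<ge> 0\<close> \<open>C \<ge> 0\<close> by (intro divide_left_mono mult_pos_pos) auto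
  also have "\<dots> \<le> Q t / (1 + Q t + C)"
  proof -
    have "q * (1 + Q t + C) \<le> Q t * (1 + q + C)"
      using mult_right_mono[OF qQ, of "1 + C"] \<open>C \<ge> 0\<close> by (simp add: algebra_simps)
    moreover have "0 < 1 + q + C" "0 < 1 + Q t + C"
      using qQ \<open>q \<ge> 0\<close> \<open>C \<ge> 0\<close> by auto
    ultimately show ?thesis
      by (simp add: pos_divide_le_eq pos_le_divide_eq)
  qed
  also have "\<dots> \<le> Q t / (1 + (D t / sqrt z)\<^sup>2)"
    using D qQ \<open>q \<ge> 0\<close> \<open>C \<ge> 0\<close>
    by (intro divide_left_mono mult_pos_pos add_pos_nonneg) auto
  finally have "q / (1 + q1 + C) / sqrt z \<le> Q t / (1 + (D t / sqrt z)\<^sup>2) / sqrt z"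
    using z by (intro divide_right_mono) auto
  moreover have "q / (1 + q1 + C) / sqrt z = sublevel_rate p (mass t) (energy t) * z powr (- p / 2)"
  proof -
    have "b\<^sup>2 = ((M\<^sup>2 / (8 * sqrt z)) powr ((p - 1) / 2))\<^sup>2 * (M\<^sup>2 / 16)"
      by (simp add: b_def power_mult_distrib power_divide)
    also have "((M\<^sup>2 / (8 * sqrt z)) powr ((p - 1) / 2))\<^sup>2 = (M\<^sup>2 / (8 * sqrt z)) powr (p - 1)"
      by (simp add: power2_eq_square powr_add[symmetric])
    also have "M\<^sup>2 / (8 * sqrt z) = (M\<^sup>2 / 8) * z powr (- (1/2))"
      using z by (simp add: powr_minus powr_half_sqrt field_simps)
    also have "\<dots> powr (p - 1) = (M\<^sup>2 / 8) powr (p - 1) * z powr (- (1/2) * (p - 1))"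
      using z by (subst powr_mult) (simp_all add: powr_powr)
    finally have b2: "b\<^sup>2 = (M\<^sup>2 / 8) powr (p - 1) * z powr (- (1/2) * (p - 1)) * (M\<^sup>2 / 16)" .
    have "z powr (- (1/2) * (p - 1)) / sqrt z = z powr (- (1/2) * (p - 1)) * z powr (- (1/2))"
      unfolding powr_minus powr_half_sqrt[OF less_imp_le[OF z(1)]] by (simp only: divide_inverse)
    also have "\<dots> = z powr (- p / 2)"
      by (simp add: powr_add[symmetric] field_simps)
    finally have zp: "z powr (- (1/2) * (p - 1)) / sqrt z = z powr (- p / 2)" .
    show ?thesis
      unfolding zp[symmetric]
      by (simp add: sublevel_rate_def q_def q1_def C_def b2 M_def \<mu>_def)
  qed
  moreover have "Q t / (1 + (D t / sqrt z)\<^sup>2) / sqrt z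
      = inverse (1 + (D t / sqrt z)\<^sup>2) * (Q t / sqrt z)"
    by (simp add: divide_inverse)
  ultimately show ?thesis
    by simp
qed

lemma sublevel_measure:
  assumes p: "p \<ge> sqrt 3" and mass: "mass 0 > 0" and z: "z > 0"
  shows "{t. t > 0 \<and> interaction (u t) \<le> z} \<in> sets lebesgue"
    and "emeasure lebesgue {t. t > 0 \<and> interaction (u t) \<le> z}
      \<le> ennreal (pi / sublevel_rate p (mass 0) (energy 0) * z powr (p / 2))"
proof -
  let ?S = "{t. t > 0 \<and> interaction (u t) \<le> z}"
  let ?\<kappa> = "sublevel_rate p (mass 0) (energy 0) * z powr (- p / 2)"
  have "closed {t. interaction (u t) \<le> z}"
    using interaction_continuous by (intro closed_Collect_le continuous_intros)
  then have "{0<..} \<inter> {t. interaction (u t) \<le> z} \<in> sets borel"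
    by (intro sets.Int) auto
  moreover have "?S = {0<..} \<inter> {t. interaction (u t) \<le> z}"
    by auto
  ultimately show S: "?S \<in> sets lebesgue"
    by simp
  have "emeasure lebesgue ?S \<le> ennreal (2 * (pi / 2) / ?\<kappa>)"
  proof (rule emeasure_le_of_derivative_ge[where G = "\<lambda>t. arctan (D t / sqrt z)"
        and g = "\<lambda>t. inverse (1 + (D t / sqrt z)\<^sup>2) * (Q t / sqrt z)"])
    show "((\<lambda>t. arctan (D t / sqrt z)) has_real_derivative
        inverse (1 + (D t / sqrt z)\<^sup>2) * (Q t / sqrt z)) (at t)" for t
      by (rule DERIV_chain2[OF DERIV_arctan DERIV_cdivide[OF D_deriv]])
    show "inverse (1 + (D t / sqrt z)\<^sup>2) * (Q t / sqrt z) \<ge> 0" for t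
      using Q_nonneg[OF p, of t] z by simp
    show "\<bar>arctan (D t / sqrt z)\<bar> \<le> pi / 2" for t
      using arctan_lbound[of "D t / sqrt z"] arctan_ubound[of "D t / sqrt z"] by linarith
    show "?\<kappa> \<le> inverse (1 + (D t / sqrt z)\<^sup>2) * (Q t / sqrt z)" if "t \<in> ?S" for t
      using arctan_rate_bound[OF p _ z, of t] mass that
      by (simp add: mass_conserved[of t] energy_conserved[of t])
    show "?\<kappa> > 0"
      using sublevel_rate_pos[OF mass] z by simp
  qed (use S in auto)
  also have "2 * (pi / 2) / ?\<kappa> = pi / sublevel_rate p (mass 0) (energy 0) * z powr (p / 2)"
  proof -
    have "z powr (- p / 2) = inverse (z powr (p / 2))"
      using powr_minus[of z "p / 2"] by simp
    moreover have "2 * (pi / 2) / (r * inverse c) = pi / r * c" for r c :: real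
      by (cases "c = 0") (simp_all add: field_simps)
    ultimately show ?thesis
      by (simp only:)
  qed
  finally show "emeasure lebesgue ?S
      \<le> ennreal (pi / sublevel_rate p (mass 0) (energy 0) * z powr (p / 2))" .
qed

text \<open>The nonzero value may occur at any time; conservation carries positivity of the mass to
  time 0.\<close>

lemma mass_pos:
  assumes "u t x \<noteq> 0"
  shows "mass 0 > 0"
  using integral_square_pos[of "u t" x] assms rapid mass_conserved[of t] by (simp add: mass_def)

end

section \<open>From Schwartz solutions to the estimate\<close>

text \<open>All derivatives in the equation exist, so \<open>deriv\<close> can be replaced by v in
  time and by the chain rule in the nonlinearity.\<close>

lemma gkdv_of_schwartz_solution:
  assumes "p > 1" "gkdv_schwartz_solution p u"
  obtains v where "gkdv p u (\<lambda>t. deriv (u t)) (\<lambda>t. (deriv ^^ 2) (u t)) (\<lambda>t. (deriv ^^ 3) (u t))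
    v (\<lambda>t. deriv (v t))"
proof -
  have C1: "schwartz_C1 u"
    and pde: "\<And>t x. deriv (\<lambda>s. u s x) t + (deriv ^^ 3) (u t) x
      = deriv (\<lambda>y. \<bar>u t y\<bar> powr (p - 1) * u t y) x"
    using assms(2) by (auto simp: gkdv_schwartz_solution_def)
  obtain v where v: "\<And>t. schwartz (u t)" "\<And>t. schwartz (v t)"
    "\<And>n t x. ((\<lambda>s. (deriv ^^ n) (u s) x) has_real_derivative (deriv ^^ n) (v t) x) (at t)"
    "\<And>n. locally_rapid (\<lambda>t. (deriv ^^ n) (u t))"
    "\<And>n. locally_rapid (\<lambda>t. (deriv ^^ n) (v t))"
    by (rule schwartz_C1E[OF C1]) (rule that)
  have ud: "(u t has_real_derivative deriv (u t) x) (at x)" for t x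
    using schwartz_has_derivative[OF v(1), of 0] by simp
  have vd: "((\<lambda>s. u s x) has_real_derivative v t x) (at t)" for t x
    using v(3)[of 0] by simp
  have "v t x = p * \<bar>u t x\<bar> powr (p - 1) * deriv (u t) x - (deriv ^^ 3) (u t) x" for t x
    using pde[of x t] DERIV_imp_deriv[OF vd]
      DERIV_imp_deriv[OF DERIV_chain2[OF has_real_derivative_abs_powr_mult[OF assms(1)] ud]]
    by simp
  then have "gkdv p u (\<lambda>t. deriv (u t)) (\<lambda>t. (deriv ^^ 2) (u t)) (\<lambda>t. (deriv ^^ 3) (u t))
    v (\<lambda>t. deriv (v t))"
    using assms(1) ud vd v(3)[of 1]
      schwartz_has_derivative[OF v(1), of 1] schwartz_has_derivative[OF v(1), of 2]
      schwartz_has_derivative[OF v(2), of 0]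
      schwartz_rapid[OF v(1), of 0] schwartz_rapid[OF v(1), of 1]
      schwartz_rapid[OF v(1), of 2] schwartz_rapid[OF v(1), of 3]
      schwartz_rapid[OF v(2), of 0] schwartz_rapid[OF v(2), of 1]
      v(4)[of 0] v(4)[of 1] v(5)[of 0] v(5)[of 1]
    by unfold_locales (simp_all add: eval_nat_numeral)
  then show thesis
    by (rule that)
qed

theorem theorem1:
  fixes p :: real and u0 :: "real \<Rightarrow> real"
  assumes "p \<ge> sqrt 3"
  shows "\<exists>C::real. C > 0 \<and>
    (\<forall>u. gkdv_schwartz_solution p u \<and> (\<exists>t x. u t x \<noteq> 0) \<and> u 0 = u0 \<longrightarrow>
      (\<forall>z>0. {t. t > 0 \<and> interaction (u t) \<le> z} \<in> sets lebesgue \<and>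
         emeasure lebesgue {t. t > 0 \<and> interaction (u t) \<le> z}
           \<le> ennreal (C * z powr (p / 2))))"
proof -
  have "1 < sqrt (3::real)"
    by (simp add: real_less_rsqrt)
  then have p: "p > 1"
    using assms by linarith
  let ?C = "pi / sublevel_rate p (gkdv_mass u0) (gkdv_energy p u0)"
  have main: "?C > 0 \<and> (\<forall>z>0. {t. t > 0 \<and> interaction (u t) \<le> z} \<in> sets lebesgue \<and>
      emeasure lebesgue {t. t > 0 \<and> interaction (u t) \<le> z} \<le> ennreal (?C * z powr (p / 2)))"
    if sol: "gkdv_schwartz_solution p u" "u t0 x0 \<noteq> 0" "u 0 = u0" for u t0 x0
  proof -
    obtain v where "gkdv p u (\<lambda>t. deriv (u t)) (\<lambda>t. (deriv ^^ 2) (u t)) (\<lambda>t. (deriv ^^ 3) (u t))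
        v (\<lambda>t. deriv (v t))"
      by (rule gkdv_of_schwartz_solution[OF p sol(1)])
    then interpret gkdv p u "\<lambda>t. deriv (u t)" "\<lambda>t. (deriv ^^ 2) (u t)" "\<lambda>t. (deriv ^^ 3) (u t)"
      v "\<lambda>t. deriv (v t)" .
    have "mass 0 = gkdv_mass u0" "energy 0 = gkdv_energy p u0"
      by (simp_all add: mass_def gkdv_mass_def energy_def e_def a_def gkdv_energy_def sol(3))
    then show ?thesis
      using mass_pos[OF sol(2)] sublevel_rate_pos[of "mass 0" "energy 0"] sublevel_measure[OF assms]
      by simp
  qed
  show ?thesis
  \<comment> \<open>Without a nonzero solution for \<open>u0\<close> the formula may fail to be
    positive: for \<open>u0\<close> = 0 it is a division by zero, with value 0. Any positive
    constant then serves.\<close>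
  proof (cases "\<exists>u. gkdv_schwartz_solution p u \<and> (\<exists>t x. u t x \<noteq> 0) \<and> u 0 = u0")
    case True
    then show ?thesis
      using main by (intro exI[of _ ?C]) blast
  next
    case False
    then show ?thesis
      by (intro exI[of _ 1]) auto
  qed
qed

end
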